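(* Let $G$ be a graph, and let $\{T_{n_1},T_{n_2},\ldots,T_{n_k}\}$ and $\{C_{m_1},C_{m_2},\ldots,C_{m_\ell}\}$ be sets of trees and cycles respectively. \begin{enumerate} \item If $G=\square_{i=1}^k T_{n_i}$ then $c_{cr}(G)=k$. \item If $G=\square_{j=1}^\ell C_{m_j}$ then $c_{cr}(G)=2\ell$. \end{enumerate}
   Context: The Cartesian product $\square_{i=1}^k G_i$ has as vertices the tuples $(a_1,\ldots,a_k)$ with $a_i\in V(G_i)$; two vertices are adjacent if they differ in exactly one coordinate $i$ and their $i$-th coordinates are adjacent in $G_i$. Cheating Robot game on a finite, simple, connected graph $G$ with $r$ cops: first the cop player places $r$ cops on vertices of $G$, then the robot is placed on a vertex. A vertex may hold more than one token. Play then proceeds in rounds: in each round, first every cop moves to a vertex in its closed neighbourhood (so a cop may stay put), and then the robot, knowing the cops' moves, moves to a vertex in his closed neighbourhood (he may stay put). Both sides have perfect information about positions. The robot is captured if either (i) at the end of the robot's move a cop and the robot are on the same vertex, or (ii) on his move the robot traverses an edge that a cop traversed on the cops' immediately preceding move. (A cop moving onto the robot's vertex does not by itself end the game; the robot still gets his move.) The cops win if they capture the robot after finitely many rounds. $c_{cr}(G)$ is the least number of cops that have a strategy guaranteeing capture of the robot on $G$.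
   Formalization: In part 1, when k ≥ 2 every tree is assumed to have at least two vertices (the claim fails otherwise, e.g. the product of K_2 and K_1 needs only one cop); k and ℓ are at least 1. *)

theory Defs
  imports "Graph_Theory.Graph_Theory" "HOL-Library.FuncSet"
begin

text \<open>
  Finite simple graphs are the \<^locale>\<open>pair_graph\<close>s of the library: an edge \<open>uv\<close> is present as the two arcs
  \<open>(u, v)\<close> and \<open>(v, u)\<close> of a loop-free symmetric relation.
\<close>

definition closed_nbhd :: "'a pair_pre_digraph \<Rightarrow> 'a \<Rightarrow> 'a set" where
  "closed_nbhd G v = insert v {w. (v, w) \<in> parcs G}"

text \<open>
  The library predicate \<^const>\<open>tree\<close> forbids all directed cycles, including \<open>u, v, u\<close>, which every
  edge of a symmetric digraph yields. The cycles of an undirected graph are those of length at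
  least 3. \<^const>\<open>connected\<close> includes that there is a vertex.
\<close>

definition tree_graph :: "'a pair_pre_digraph \<Rightarrow> bool" where
  "tree_graph G \<longleftrightarrow> pair_graph G \<and> connected (with_proj G) \<and>
     \<not> (\<exists>p. pre_digraph.cycle (with_proj G) p \<and> 3 \<le> length p)"

definition cycle_graph :: "nat \<Rightarrow> 'a pair_pre_digraph \<Rightarrow> bool" where
  "cycle_graph m G \<longleftrightarrow> 3 \<le> m \<and>
     (\<exists>v. bij_betw v {..<m} (pverts G) \<and>
          parcs G = (\<Union>i<m. {(v i, v (Suc i mod m)), (v (Suc i mod m), v i)}))"

definition cartesian_product ::
    "'i set \<Rightarrow> ('i \<Rightarrow> 'a pair_pre_digraph) \<Rightarrow> ('i \<Rightarrow> 'a) pair_pre_digraph" where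
  "cartesian_product I G =
     \<lparr> pverts = (\<Pi>\<^sub>E i\<in>I. pverts (G i)),
       parcs = {(a, b). a \<in> (\<Pi>\<^sub>E i\<in>I. pverts (G i)) \<and> b \<in> (\<Pi>\<^sub>E i\<in>I. pverts (G i)) \<and>
                  (\<exists>i\<in>I. {j\<in>I. a j \<noteq> b j} = {i} \<and> (a i, b i) \<in> parcs (G i))} \<rparr>"

text \<open>
  A cop strategy maps the list of robot positions seen so far, in chronological order, to the
  positions of the cops (cop \<open>i\<close> is at the \<open>i\<close>-th one, \<open>i < r\<close>): \<open>S []\<close> is the initial placement,
  made before the robot is placed, and \<open>S [R 0, ..., R t]\<close> is the placement after the cops'
  move in round \<open>t\<close>, in which the robot starts at \<open>R t\<close> and answers by moving to \<open>R (Suc t)\<close>.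
  The cops' own earlier positions are determined by \<open>S\<close> and the robot's positions. As a strategy
  is deterministic, it beats every robot who sees the cops' moves iff it beats every fixed
  sequence of robot moves.
\<close>

type_synonym 'a cop_strategy = "'a list \<Rightarrow> nat \<Rightarrow> 'a"

definition robot_play :: "'a pair_pre_digraph \<Rightarrow> (nat \<Rightarrow> 'a) \<Rightarrow> bool" where
  "robot_play G R \<longleftrightarrow> R 0 \<in> pverts G \<and> (\<forall>t. R (Suc t) \<in> closed_nbhd G (R t))"

definition cop_pos :: "'a cop_strategy \<Rightarrow> (nat \<Rightarrow> 'a) \<Rightarrow> nat \<Rightarrow> nat \<Rightarrow> 'a" where
  "cop_pos S R t = S (map R [0..<t])"

definition legal_strategy :: "'a pair_pre_digraph \<Rightarrow> nat \<Rightarrow> 'a cop_strategy \<Rightarrow> bool" where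
  "legal_strategy G r S \<longleftrightarrow>
     (\<forall>i<r. S [] i \<in> pverts G) \<and>
     (\<forall>R. robot_play G R \<longrightarrow>
        (\<forall>t. \<forall>i<r. cop_pos S R (Suc t) i \<in> closed_nbhd G (cop_pos S R t i)))"

text \<open>
  The second disjunct says that in round \<open>t\<close> the robot and some cop traversed the same edge, in
  either direction; since \<open>R t \<noteq> R (Suc t)\<close>, equality of the two sets forces the cop to move.
\<close>

definition captured_in_round :: "nat \<Rightarrow> 'a cop_strategy \<Rightarrow> (nat \<Rightarrow> 'a) \<Rightarrow> nat \<Rightarrow> bool" where
  "captured_in_round r S R t \<longleftrightarrow>
     (\<exists>i<r. cop_pos S R (Suc t) i = R (Suc t)) \<or>
     (R t \<noteq> R (Suc t) \<and>
       (\<exists>i<r. {cop_pos S R t i, cop_pos S R (Suc t) i} = {R t, R (Suc t)}))"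

definition cops_win :: "'a pair_pre_digraph \<Rightarrow> nat \<Rightarrow> bool" where
  "cops_win G r \<longleftrightarrow>
     (\<exists>S. legal_strategy G r S \<and>
        (\<forall>R. robot_play G R \<longrightarrow> (\<exists>t. captured_in_round r S R t)))"

definition c_cr :: "'a pair_pre_digraph \<Rightarrow> nat" where
  "c_cr G = (LEAST r. cops_win G r)"

end

theory Submission
  imports Defs
begin

text \<open>
  The lower bounds come from the minimum degree \<open>\<delta>\<close>: after the cops' move each cop blocks at most one
  neighbour of the robot's vertex, so fewer than \<open>\<delta>\<close> cops never capture him (\<open>not_cops_win\<close>). A product
  of \<open>k\<close> trees with at least two vertices each has \<open>\<delta> \<ge> k\<close>, a product of \<open>l\<close> cycles has \<open>\<delta> = 2l\<close>.

  For the upper bounds every cop is made responsible for one coordinate \<open>c\<close>. He first steps towards the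
  robot in the other coordinates, and once they agree he plays a pursuit strategy of the factor in
  coordinate \<open>c\<close> (\<open>align_then\<close>). The distance in the other coordinates, taken after the cops' moves,
  never increases and drops whenever the robot does not move in those coordinates. So in an infinite
  play it becomes constant, and either the robot never moves in coordinate \<open>c\<close> any more, or the cop is
  aligned for good (\<open>aligned_or_running\<close>). In the second case the play in coordinate \<open>c\<close> is a play on
  the factor, interrupted only by robot moves in other coordinates, which the cop copies.

  On a factor, all cops but one are guards. A guard trails the robot without stepping onto him. In a
  tree he shrinks the component to which the robot is confined and thereby allows only finitely many moves; in
  a cycle he does so for the moves in one direction, and two guards with opposite directions stop all
  moves. Hence an uncaptured robot would eventually move only in the first coordinate, and there, for a
  cycle, in one direction only. The remaining cop then aligns himself and catches him by plain pursuit: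
  when he steps onto the robot's vertex, the robot can neither stay nor go back along the edge just
  used (\<open>cops_win_product\<close>).
\<close>

section \<open>Distances in a connected graph\<close>

text \<open>
  A nonempty digraph with arcs between its vertices that is strongly connected; symmetric arcs are the
  intended case.
\<close>

definition conn_graph :: "'a pair_pre_digraph \<Rightarrow> bool" where
  "conn_graph H \<longleftrightarrow> pverts H \<noteq> {} \<and> parcs H \<subseteq> pverts H \<times> pverts H \<and>
     (\<forall>u\<in>pverts H. \<forall>v\<in>pverts H. (u, v) \<in> (parcs H)\<^sup>*)"

text \<open>The length of a shortest walk from \<open>u\<close> to \<open>v\<close>; it is meaningful only if there is a walk.\<close>

definition gdist :: "'a pair_pre_digraph \<Rightarrow> 'a \<Rightarrow> 'a \<Rightarrow> nat" where
  "gdist H u v = (LEAST n. (u, v) \<in> parcs H ^^ n)"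

text \<open>
  Some neighbour of \<open>p\<close> that is nearer to \<open>r\<close>; the truncated subtraction makes \<open>p\<close> itself an admissible
  choice when \<open>p = r\<close>.
\<close>

definition step_towards :: "'a pair_pre_digraph \<Rightarrow> 'a \<Rightarrow> 'a \<Rightarrow> 'a" where
  "step_towards H p r = (SOME q. q \<in> closed_nbhd H p \<and> gdist H q r \<le> gdist H p r - 1)"

lemma closed_nbhd_in_pverts:
  assumes "conn_graph H" "v \<in> pverts H" "w \<in> closed_nbhd H v"
  shows "w \<in> pverts H"
  using assms by (auto simp: conn_graph_def closed_nbhd_def)

lemma relpow_gdist:
  assumes "conn_graph H" "u \<in> pverts H" "v \<in> pverts H"
  shows "(u, v) \<in> parcs H ^^ gdist H u v"
proof -
  have "(u, v) \<in> (parcs H)\<^sup>*"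
    using assms by (simp add: conn_graph_def)
  then obtain n where "(u, v) \<in> parcs H ^^ n"
    by (auto simp: rtrancl_power)
  then show ?thesis
    unfolding gdist_def by (rule LeastI)
qed

lemma gdist_le: "(u, v) \<in> parcs H ^^ n \<Longrightarrow> gdist H u v \<le> n"
  unfolding gdist_def by (rule Least_le)

lemma gdist_self [simp]: "gdist H u u = 0"
  using gdist_le[where n = 0 and u = u and v = u and H = H] by simp

lemma gdist_eq_0:
  assumes "conn_graph H" "u \<in> pverts H" "v \<in> pverts H"
  shows "gdist H u v = 0 \<longleftrightarrow> u = v"
  using relpow_gdist[OF assms] by auto

lemma gdist_target_step:
  assumes "conn_graph H" "p \<in> pverts H" "r \<in> pverts H" "r' \<in> closed_nbhd H r"
  shows "gdist H p r' \<le> gdist H p r + 1"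
proof (cases "r' = r")
  case False
  then have "(r, r') \<in> parcs H"
    using assms(4) by (auto simp: closed_nbhd_def)
  then have "(p, r') \<in> parcs H ^^ Suc (gdist H p r)"
    using relpow_gdist[OF assms(1-3)] by auto
  then show ?thesis
    using gdist_le by fastforce
qed simp

lemma step_towards:
  assumes "conn_graph H" "p \<in> pverts H" "r \<in> pverts H"
  shows step_towards_closed_nbhd: "step_towards H p r \<in> closed_nbhd H p"
    and gdist_step_towards: "gdist H (step_towards H p r) r \<le> gdist H p r - 1"
proof -
  have "\<exists>q. q \<in> closed_nbhd H p \<and> gdist H q r \<le> gdist H p r - 1"
  proof (cases "gdist H p r")
    case 0
    then show ?thesis
      by (intro exI[of _ p]) (simp add: closed_nbhd_def)
  next
    case (Suc n)
    then have "(p, r) \<in> parcs H ^^ Suc n"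
      using relpow_gdist[OF assms] by simp
    then obtain q where "(p, q) \<in> parcs H" "(q, r) \<in> parcs H ^^ n"
      by (rule relpow_Suc_E2)
    then show ?thesis
      using Suc gdist_le[where n = n and u = q and v = r and H = H] by (auto simp: closed_nbhd_def)
  qed
  from someI_ex[OF this]
  show "step_towards H p r \<in> closed_nbhd H p" "gdist H (step_towards H p r) r \<le> gdist H p r - 1"
    by (auto simp: step_towards_def)
qed

section \<open>Pursuit in one coordinate\<close>

text \<open>
  A cop at \<open>p\<close> moves, in answer to a robot at \<open>r\<close>, to \<open>g p r\<close>. The strategy \<open>g\<close> guards the set \<open>A\<close>
  of arcs if the robot, as long as he does not step onto the cop, runs only finitely often along arcs
  of \<open>A\<close>. This is witnessed by a potential \<open>\<Phi>\<close> that never increases and that drops at every robot move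
  along \<open>A\<close>. Here \<open>\<Phi>\<close> is evaluated after the cop's move, so \<open>p = r\<close> is possible: in a product the cop
  may reach the robot by a move in another coordinate. Rounds in which the robot stays put are included.
\<close>

definition guards :: "'a pair_pre_digraph \<Rightarrow> ('a \<Rightarrow> 'a \<Rightarrow> 'a) \<Rightarrow> 'a rel \<Rightarrow> bool" where
  "guards H g A \<longleftrightarrow> (\<exists>\<Phi> :: 'a \<Rightarrow> 'a \<Rightarrow> nat.
     \<forall>p\<in>pverts H. \<forall>r\<in>pverts H. \<forall>r'\<in>closed_nbhd H r. r' \<noteq> p \<longrightarrow>
       \<Phi> (g p r') r' \<le> \<Phi> p r \<and> (r \<noteq> r' \<and> (r, r') \<in> A \<longrightarrow> \<Phi> (g p r') r' < \<Phi> p r))"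

text \<open>
  The strategy \<open>g\<close> catches a robot who from some time on only stays put or runs along arcs of \<open>B\<close>. The
  potential \<open>\<Psi>\<close> is evaluated before the cop's move, after which the robot answers by moving from \<open>r\<close>
  to \<open>r'\<close>; it drops in every round without a capture. A position \<open>p = r\<close> before the cop's move
  is excluded: except in the initial placement, it is a capture.
\<close>

definition catches :: "'a pair_pre_digraph \<Rightarrow> ('a \<Rightarrow> 'a \<Rightarrow> 'a) \<Rightarrow> 'a rel \<Rightarrow> bool" where
  "catches H g B \<longleftrightarrow> (\<exists>\<Psi> :: 'a \<Rightarrow> 'a \<Rightarrow> nat.
     \<forall>p\<in>pverts H. \<forall>r\<in>pverts H. \<forall>r'\<in>closed_nbhd H r.
       p \<noteq> r \<and> (r' = r \<or> (r, r') \<in> B) \<and> r' \<noteq> g p r \<and> (r \<noteq> r' \<longrightarrow> {p, g p r} \<noteq> {r, r'}) \<longrightarrow>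
       \<Psi> (g p r) r' < \<Psi> p r)"

section \<open>From one coordinate to the product\<close>

text \<open>
  The strategy of a cop who is responsible for coordinate \<open>c\<close>: as long as some other coordinate differs
  from the robot's, step towards the robot there; once all of them agree, play \<open>g\<close> in coordinate \<open>c\<close>.
\<close>

definition align_then ::
    "'i set \<Rightarrow> ('i \<Rightarrow> 'a pair_pre_digraph) \<Rightarrow> 'i \<Rightarrow> ('a \<Rightarrow> 'a \<Rightarrow> 'a) \<Rightarrow> ('i \<Rightarrow> 'a) \<Rightarrow> ('i \<Rightarrow> 'a) \<Rightarrow> 'i \<Rightarrow> 'a"
  where
  "align_then I H c g p r =
     (if \<exists>j\<in>I - {c}. p j \<noteq> r j
      then let j = SOME j. j \<in> I - {c} \<and> p j \<noteq> r j in p(j := step_towards (H j) (p j) (r j))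
      else p(c := g (p c) (r c)))"

lemma pverts_cartesian_product [simp]:
  "pverts (cartesian_product I H) = (\<Pi>\<^sub>E i\<in>I. pverts (H i))"
  by (simp add: cartesian_product_def)

lemma closed_nbhd_product_cases:
  assumes "b \<in> closed_nbhd (cartesian_product I H) a"
  obtains (stay) "b = a"
  | (move) i where "i \<in> I" "(a i, b i) \<in> parcs (H i)" "a i \<noteq> b i" "\<And>j. j \<noteq> i \<Longrightarrow> b j = a j"
proof (cases "b = a")
  case False
  then have ab: "a \<in> (\<Pi>\<^sub>E i\<in>I. pverts (H i))" "b \<in> (\<Pi>\<^sub>E i\<in>I. pverts (H i))"
    and "\<exists>i\<in>I. {j\<in>I. a j \<noteq> b j} = {i} \<and> (a i, b i) \<in> parcs (H i)"
    using assms unfolding closed_nbhd_def cartesian_product_def by simp_all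
  then obtain i where i: "i \<in> I" "{j\<in>I. a j \<noteq> b j} = {i}" "(a i, b i) \<in> parcs (H i)"
    by metis
  have eq: "b j = a j" if "j \<noteq> i" for j
  proof (cases "j \<in> I")
    case True
    then have "a j \<noteq> b j \<longleftrightarrow> j = i"
      using i(2) by blast
    then show ?thesis using that by simp
  next
    case False
    then show ?thesis
      using PiE_arb[OF ab(1)] PiE_arb[OF ab(2)] by simp
  qed
  have "a i \<noteq> b i"
    using i(2) by blast
  then show ?thesis
    using eq by (rule move[OF i(1,3)])
qed (rule stay)

lemma fun_upd_closed_nbhd_product:
  assumes "\<And>i. i \<in> I \<Longrightarrow> conn_graph (H i)" "a \<in> (\<Pi>\<^sub>E i\<in>I. pverts (H i))" "i \<in> I"
    and "w \<in> closed_nbhd (H i) (a i)"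
  shows "a(i := w) \<in> closed_nbhd (cartesian_product I H) a"
proof (cases "w = a i")
  case False
  then have w: "(a i, w) \<in> parcs (H i)"
    using assms(4) by (auto simp: closed_nbhd_def)
  have "w \<in> pverts (H i)"
    using assms closed_nbhd_in_pverts by (metis PiE_mem)
  then have "a(i := w) \<in> (\<Pi>\<^sub>E i\<in>I. pverts (H i))"
    using assms(2,3) by (auto simp: PiE_iff extensional_def)
  moreover have "{j\<in>I. a j \<noteq> (a(i := w)) j} = {i}"
    using assms(3) False by auto
  ultimately show ?thesis
    using assms(2,3) w unfolding closed_nbhd_def cartesian_product_def by auto
qed (simp add: closed_nbhd_def)

lemma closed_nbhd_product_in:
  assumes "a \<in> (\<Pi>\<^sub>E i\<in>I. pverts (H i))" and "b \<in> closed_nbhd (cartesian_product I H) a"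
  shows "b \<in> (\<Pi>\<^sub>E i\<in>I. pverts (H i))"
  using assms by (auto simp: closed_nbhd_def cartesian_product_def)

lemma closed_nbhd_product_coordinate:
  assumes "b \<in> closed_nbhd (cartesian_product I H) a"
  shows "b i \<in> closed_nbhd (H i) (a i)"
  using assms
proof (cases rule: closed_nbhd_product_cases)
  case (move j)
  then show ?thesis
    by (cases "i = j") (simp_all add: closed_nbhd_def)
qed (simp add: closed_nbhd_def)

lemma eq_by_coordinate: "(\<And>j. j \<noteq> c \<Longrightarrow> p j = r j) \<Longrightarrow> p c = r c \<Longrightarrow> p = r"
  by (rule ext) metis

lemma antimono_nat_eventually_const:
  fixes f :: "nat \<Rightarrow> nat"
  assumes "\<And>t. t \<ge> a \<Longrightarrow> f (Suc t) \<le> f t"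
  obtains N where "N \<ge> a" "\<And>t. t \<ge> N \<Longrightarrow> f t = f N"
proof -
  define n where "n = (LEAST n. \<exists>t\<ge>a. f t = n)"
  have "\<exists>t\<ge>a. f t = n"
    unfolding n_def by (rule LeastI[of _ "f a"]) auto
  then obtain N where N: "N \<ge> a" "f N = n"
    by blast
  have "f t = n" if "t \<ge> N" for t
    using that
  proof (induction t rule: dec_induct)
    case (step t)
    then have "f (Suc t) \<le> n"
      using assms[of t] N(1) by simp
    moreover have "n \<le> f (Suc t)"
      unfolding n_def by (rule Least_le) (use step(1) N(1) in \<open>auto intro!: exI[of _ "Suc t"]\<close>)
    ultimately show ?case by simp
  qed (use N in simp)
  then show ?thesis
    using that N by metis
qed

lemma align_then_closed_nbhd:
  assumes "\<And>i. i \<in> I \<Longrightarrow> conn_graph (H i)" and "c \<in> I"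
    and "\<And>p r. p \<in> pverts (H c) \<Longrightarrow> r \<in> pverts (H c) \<Longrightarrow> g p r \<in> closed_nbhd (H c) p"
    and "p \<in> (\<Pi>\<^sub>E i\<in>I. pverts (H i))" "r \<in> (\<Pi>\<^sub>E i\<in>I. pverts (H i))"
  shows "align_then I H c g p r \<in> closed_nbhd (cartesian_product I H) p"
proof (cases "\<exists>j\<in>I - {c}. p j \<noteq> r j")
  case True
  define j where "j = (SOME j. j \<in> I - {c} \<and> p j \<noteq> r j)"
  have j: "j \<in> I"
    using True someI_ex[of "\<lambda>j. j \<in> I - {c} \<and> p j \<noteq> r j"] unfolding j_def by blast
  then have "step_towards (H j) (p j) (r j) \<in> closed_nbhd (H j) (p j)"
    using assms by (intro step_towards_closed_nbhd) auto
  then show ?thesis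
    using True j assms fun_upd_closed_nbhd_product[of I H p j]
    unfolding align_then_def j_def[symmetric] Let_def by simp
next
  case False
  have "g (p c) (r c) \<in> closed_nbhd (H c) (p c)"
    using assms by (metis PiE_mem)
  then have "p(c := g (p c) (r c)) \<in> closed_nbhd (cartesian_product I H) p"
    by (intro fun_upd_closed_nbhd_product assms(1,2,4))
  then show ?thesis
    using False by (simp add: align_then_def)
qed

text \<open>
  A play in which the robot, at \<open>R t\<close> at the start of round \<open>t\<close>, is never captured by one particular cop,
  who follows \<open>align_then\<close> and moves from \<open>P t\<close> to \<open>P (Suc t)\<close> in that round.
\<close>

locale product_chase =
  fixes I :: "'i set" and H :: "'i \<Rightarrow> 'a pair_pre_digraph" and c :: 'i and g :: "'a \<Rightarrow> 'a \<Rightarrow> 'a"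
    and P R :: "nat \<Rightarrow> 'i \<Rightarrow> 'a"
  assumes finite_I: "finite I" and c_in: "c \<in> I"
    and conn: "\<And>i. i \<in> I \<Longrightarrow> conn_graph (H i)"
    and g_closed: "\<And>p r. p \<in> pverts (H c) \<Longrightarrow> r \<in> pverts (H c) \<Longrightarrow> g p r \<in> closed_nbhd (H c) p"
    and P0: "P 0 \<in> (\<Pi>\<^sub>E i\<in>I. pverts (H i))"
    and P_Suc: "\<And>t. P (Suc t) = align_then I H c g (P t) (R t)"
    and play: "robot_play (cartesian_product I H) R"
    and not_hit: "\<And>t. P (Suc t) \<noteq> R (Suc t)"
    and not_crossed: "\<And>t. R t \<noteq> R (Suc t) \<Longrightarrow> {P t, P (Suc t)} \<noteq> {R t, R (Suc t)}"
begin

abbreviation V where "V \<equiv> (\<Pi>\<^sub>E i\<in>I. pverts (H i))"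

lemma R_in: "R t \<in> V"
proof (induction t)
  case (Suc t)
  then show ?case
    using play closed_nbhd_product_in unfolding robot_play_def by blast
qed (use play in \<open>simp add: robot_play_def\<close>)

lemma P_in: "P t \<in> V"
proof (induction t)
  case (Suc t)
  show ?case
    unfolding P_Suc
    by (rule closed_nbhd_product_in[OF Suc], rule align_then_closed_nbhd)
      (intro conn c_in g_closed R_in Suc | assumption)+
qed (rule P0)

lemma R_step: "R (Suc t) \<in> closed_nbhd (cartesian_product I H) (R t)"
  using play by (simp add: robot_play_def)

lemma coordinate_in: "P t c \<in> pverts (H c)" "R t c \<in> pverts (H c)"
  using P_in R_in c_in by (auto simp: PiE_iff)

lemma R_step_c: "R (Suc t) c \<in> closed_nbhd (H c) (R t c)"
  by (rule closed_nbhd_product_coordinate[OF R_step])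

text \<open>The distance of two positions when coordinate \<open>c\<close> is ignored.\<close>

definition off_dist :: "('i \<Rightarrow> 'a) \<Rightarrow> ('i \<Rightarrow> 'a) \<Rightarrow> nat" where
  "off_dist p r = (\<Sum>j\<in>I - {c}. gdist (H j) (p j) (r j))"

lemma agree_outside: "p \<in> V \<Longrightarrow> r \<in> V \<Longrightarrow> j \<notin> I \<Longrightarrow> p j = r j"
  using PiE_arb[of p I _ j] PiE_arb[of r I _ j] by simp

lemma off_dist_eq_0:
  assumes "p \<in> V" "r \<in> V"
  shows "off_dist p r = 0 \<longleftrightarrow> (\<forall>j. j \<noteq> c \<longrightarrow> p j = r j)"
proof -
  have eq0: "gdist (H j) (p j) (r j) = 0 \<longleftrightarrow> p j = r j" if "j \<in> I" for j
    using PiE_mem[OF assms(1) that] PiE_mem[OF assms(2) that] by (rule gdist_eq_0[OF conn[OF that]])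
  have "off_dist p r = 0 \<longleftrightarrow> (\<forall>j\<in>I - {c}. gdist (H j) (p j) (r j) = 0)"
    unfolding off_dist_def using finite_I by simp
  also have "\<dots> \<longleftrightarrow> (\<forall>j\<in>I - {c}. p j = r j)"
    using eq0 by simp
  also have "\<dots> \<longleftrightarrow> (\<forall>j. j \<noteq> c \<longrightarrow> p j = r j)"
  proof
    assume eq: "\<forall>j\<in>I - {c}. p j = r j"
    show "\<forall>j. j \<noteq> c \<longrightarrow> p j = r j"
    proof (intro allI impI)
      fix j assume "j \<noteq> c"
      then show "p j = r j"
        using eq agree_outside[OF assms, of j] by (cases "j \<in> I") simp_all
    qed
  qed simp
  finally show ?thesis .
qed

lemma align_then_off:
  assumes "p \<in> V" "r \<in> V" "\<exists>j. j \<noteq> c \<and> p j \<noteq> r j"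
  shows "off_dist (align_then I H c g p r) r < off_dist p r"
    and "align_then I H c g p r c = p c"
proof -
  have ex: "\<exists>j. j \<in> I - {c} \<and> p j \<noteq> r j"
    using assms(3) agree_outside[OF assms(1,2)] by blast
  define j where "j = (SOME j. j \<in> I - {c} \<and> p j \<noteq> r j)"
  have j: "j \<in> I - {c}" "p j \<noteq> r j"
    using someI_ex[OF ex] unfolding j_def[symmetric] by simp_all
  define q where "q = p(j := step_towards (H j) (p j) (r j))"
  have q: "align_then I H c g p r = q"
    unfolding align_then_def j_def[symmetric] q_def Let_def by (rule if_P) (use ex in blast)
  have pr: "p j \<in> pverts (H j)" "r j \<in> pverts (H j)"
    using assms j by (auto simp: PiE_iff)
  have "gdist (H j) (step_towards (H j) (p j) (r j)) (r j) \<le> gdist (H j) (p j) (r j) - 1"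
    using conn j(1) pr by (intro gdist_step_towards) auto
  moreover have "gdist (H j) (p j) (r j) \<noteq> 0"
    using conn j pr by (simp add: gdist_eq_0)
  ultimately have less: "gdist (H j) (q j) (r j) < gdist (H j) (p j) (r j)"
    by (simp add: q_def)
  have "off_dist q r < off_dist p r"
    unfolding off_dist_def
  proof (rule sum_strict_mono_ex1)
    show "\<forall>i\<in>I - {c}. gdist (H i) (q i) (r i) \<le> gdist (H i) (p i) (r i)"
      using less by (auto simp: q_def)
    show "\<exists>i\<in>I - {c}. gdist (H i) (q i) (r i) < gdist (H i) (p i) (r i)"
      using less j by blast
  qed (use finite_I in simp)
  then show "off_dist (align_then I H c g p r) r < off_dist p r"
    by (simp add: q)
  show "align_then I H c g p r c = p c"
    using j(1) unfolding q q_def by auto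
qed

lemma align_then_on:
  assumes "\<forall>j. j \<noteq> c \<longrightarrow> p j = r j"
  shows "align_then I H c g p r = p(c := g (p c) (r c))"
  using assms by (auto simp: align_then_def)

lemma off_dist_robot_step:
  assumes "p \<in> V" "r \<in> V" "r' \<in> closed_nbhd (cartesian_product I H) r"
  shows "off_dist p r' \<le> off_dist p r + 1"
    and "\<forall>j. j \<noteq> c \<longrightarrow> r j = r' j \<Longrightarrow> off_dist p r' = off_dist p r"
proof -
  show eq: "off_dist p r' = off_dist p r" if "\<forall>j. j \<noteq> c \<longrightarrow> r j = r' j"
    unfolding off_dist_def by (rule sum.cong) (use that in auto)
  show "off_dist p r' \<le> off_dist p r + 1"
    using assms(3)
  proof (cases rule: closed_nbhd_product_cases)
    case (move i)
    show ?thesis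
    proof (cases "i = c")
      case True
      then show ?thesis
        using eq move(4) by simp
    next
      case False
      then have i: "i \<in> I - {c}"
        using move(1) by simp
      have "off_dist p r' = gdist (H i) (p i) (r' i) + (\<Sum>j\<in>I - {c} - {i}. gdist (H j) (p j) (r' j))"
        unfolding off_dist_def using finite_I i by (simp add: sum.remove)
      also have "(\<Sum>j\<in>I - {c} - {i}. gdist (H j) (p j) (r' j)) = (\<Sum>j\<in>I - {c} - {i}. gdist (H j) (p j) (r j))"
        by (rule sum.cong) (simp_all add: move(4))
      also have "gdist (H i) (p i) (r' i) \<le> gdist (H i) (p i) (r i) + 1"
        using conn i assms move(2) by (intro gdist_target_step) (auto simp: PiE_iff closed_nbhd_def)
      also have "gdist (H i) (p i) (r i) + 1 + (\<Sum>j\<in>I - {c} - {i}. gdist (H j) (p j) (r j)) = off_dist p r + 1"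
        unfolding off_dist_def using finite_I i by (simp add: sum.remove)
      finally show ?thesis by simp
    qed
  qed simp
qed

abbreviation off_move :: "nat \<Rightarrow> bool" where
  "off_move t \<equiv> \<exists>j. j \<noteq> c \<and> R t j \<noteq> R (Suc t) j"

lemma off_move_c:
  assumes "off_move t"
  shows "R (Suc t) c = R t c"
  using R_step[of t]
proof (cases rule: closed_nbhd_product_cases)
  case (move i)
  then show ?thesis using assms move(4) by metis
qed (use assms in simp)

text \<open>
  A robot move increases the distance off \<open>c\<close> by at most one, and the cop's answer makes up for it. Hence
  the distance after the cop's moves never increases, and every round in which the robot does not move
  off \<open>c\<close> is a tempo gained by the cop.
\<close>

lemma off_dist_decreases:
  shows "off_dist (P (Suc (Suc t))) (R (Suc t)) \<le> off_dist (P (Suc t)) (R t)"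
    and "\<not> off_move t \<Longrightarrow> off_dist (P (Suc t)) (R t) \<noteq> 0 \<Longrightarrow>
      off_dist (P (Suc (Suc t))) (R (Suc t)) < off_dist (P (Suc t)) (R t)"
proof -
  let ?D = "off_dist (P (Suc t)) (R t)"
  have le: "off_dist (P (Suc t)) (R (Suc t)) \<le> ?D + 1"
    and eq: "\<not> off_move t \<Longrightarrow> off_dist (P (Suc t)) (R (Suc t)) = ?D"
    using off_dist_robot_step[OF P_in R_in R_step] by blast+
  have step: "off_dist (P (Suc (Suc t))) (R (Suc t)) < off_dist (P (Suc t)) (R (Suc t)) \<or>
     off_dist (P (Suc t)) (R (Suc t)) = 0 \<and> off_dist (P (Suc (Suc t))) (R (Suc t)) = 0"
  proof (cases "\<exists>j. j \<noteq> c \<and> P (Suc t) j \<noteq> R (Suc t) j")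
    case True
    then show ?thesis
      using align_then_off(1)[OF P_in R_in True] P_Suc by metis
  next
    case False
    then have "P (Suc (Suc t)) = (P (Suc t))(c := g (P (Suc t) c) (R (Suc t) c))"
      using align_then_on P_Suc by metis
    then show ?thesis
      using False off_dist_eq_0[OF P_in R_in] by (metis fun_upd_other)
  qed
  show "off_dist (P (Suc (Suc t))) (R (Suc t)) \<le> ?D"
    using le step by linarith
  show "off_dist (P (Suc (Suc t))) (R (Suc t)) < ?D" if "\<not> off_move t" "?D \<noteq> 0"
    using eq[OF that(1)] that(2) step by linarith
qed

text \<open>
  The distance off \<open>c\<close> is eventually constant. If the constant is positive, the robot always has to move
  off \<open>c\<close>; if it is \<open>0\<close>, the cop agrees with the robot off \<open>c\<close> after every cop move.
\<close>

lemma aligned_or_running: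
  obtains (running) N where "\<forall>t\<ge>N. off_move t"
  | (aligned) N where "\<forall>t\<ge>N. \<forall>j. j \<noteq> c \<longrightarrow> P (Suc t) j = R t j"
proof -
  obtain N where N: "\<And>t. t \<ge> N \<Longrightarrow> off_dist (P (Suc t)) (R t) = off_dist (P (Suc N)) (R N)"
    using antimono_nat_eventually_const[of 0 "\<lambda>t. off_dist (P (Suc t)) (R t)"] off_dist_decreases(1)
    by blast
  show ?thesis
  proof (cases "off_dist (P (Suc N)) (R N) = 0")
    case True
    then have "off_dist (P (Suc t)) (R t) = 0" if "t \<ge> N" for t
      using N[OF that] by simp
    then have "\<forall>t\<ge>N. \<forall>j. j \<noteq> c \<longrightarrow> P (Suc t) j = R t j"
      using off_dist_eq_0[OF P_in R_in] by blast
    then show ?thesis by (rule aligned)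
  next
    case False
    have "off_move t" if "t \<ge> N" for t
    proof (rule ccontr)
      assume "\<not> off_move t"
      then have "off_dist (P (Suc (Suc t))) (R (Suc t)) < off_dist (P (Suc t)) (R t)"
        using off_dist_decreases(2) False N[OF that] by metis
      then show False
        using N[OF that] N[of "Suc t"] that by simp
    qed
    then show ?thesis using running by blast
  qed
qed

text \<open>
  In the aligned case a robot move off \<open>c\<close> is copied by the cop and leaves the positions in coordinate
  \<open>c\<close> as they were, so the game in coordinate \<open>c\<close> is merely suspended.
\<close>

lemma guards_finitely_many_moves:
  assumes "guards (H c) g A"
  shows "\<exists>N. \<forall>t\<ge>N. R t c = R (Suc t) c \<or> (R t c, R (Suc t) c) \<notin> A"
proof (cases rule: aligned_or_running)
  case (running N)
  then show ?thesis
    using off_move_c by metis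
next
  case (aligned N)
  then have al: "P (Suc t) j = R t j" if "t \<ge> N" "j \<noteq> c" for t j
    using that by blast
  obtain \<Phi> :: "'a \<Rightarrow> 'a \<Rightarrow> nat" where \<Phi>:
    "\<And>p r r'. p \<in> pverts (H c) \<Longrightarrow> r \<in> pverts (H c) \<Longrightarrow> r' \<in> closed_nbhd (H c) r \<Longrightarrow> r' \<noteq> p \<Longrightarrow>
       \<Phi> (g p r') r' \<le> \<Phi> p r \<and> (r \<noteq> r' \<and> (r, r') \<in> A \<longrightarrow> \<Phi> (g p r') r' < \<Phi> p r)"
    using assms unfolding guards_def by blast
  define f where "f t = \<Phi> (P (Suc t) c) (R t c)" for t
  have f: "f (Suc t) \<le> f t \<and> (R t c \<noteq> R (Suc t) c \<and> (R t c, R (Suc t) c) \<in> A \<longrightarrow> f (Suc t) < f t)"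
    if t: "t \<ge> N" for t
  proof (cases "off_move t")
    case True
    then obtain j where j: "j \<noteq> c" "R t j \<noteq> R (Suc t) j"
      by blast
    then have "P (Suc t) j \<noteq> R (Suc t) j"
      using al[OF t j(1)] by simp
    then have "P (Suc (Suc t)) c = P (Suc t) c"
      using align_then_off(2)[OF P_in R_in] P_Suc j(1) by metis
    then show ?thesis
      using off_move_c[OF True] by (simp add: f_def)
  next
    case False
    then have eq: "\<forall>j. j \<noteq> c \<longrightarrow> P (Suc t) j = R (Suc t) j"
      using al[OF t] by metis
    then have "P (Suc (Suc t)) c = g (P (Suc t) c) (R (Suc t) c)"
      using align_then_on P_Suc by (metis fun_upd_same)
    moreover have "R (Suc t) c \<noteq> P (Suc t) c"
      using eq not_hit[of t] eq_by_coordinate[of c "P (Suc t)" "R (Suc t)"] by metis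
    ultimately show ?thesis
      using \<Phi>[OF coordinate_in R_step_c] by (simp add: f_def)
  qed
  obtain N' where N': "N' \<ge> N" "\<And>t. t \<ge> N' \<Longrightarrow> f t = f N'"
    using antimono_nat_eventually_const[of N f] f by blast
  have "R t c = R (Suc t) c \<or> (R t c, R (Suc t) c) \<notin> A" if "t \<ge> N'" for t
    using f[of t] N' that by (metis le_SucI le_trans nat_less_le)
  then show ?thesis by blast
qed

text \<open>
  A robot who eventually moves in coordinate \<open>c\<close> only cannot keep the cop misaligned, and then plays the
  game in coordinate \<open>c\<close> against \<open>g\<close>.
\<close>

lemma catches_captures:
  assumes "catches (H c) g B"
    and off: "\<And>t. t \<ge> N \<Longrightarrow> \<not> off_move t"
    and on: "\<And>t. t \<ge> N \<Longrightarrow> R (Suc t) c = R t c \<or> (R t c, R (Suc t) c) \<in> B"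
  shows False
proof (cases rule: aligned_or_running)
  case (running M)
  then show False
    using off[of "max M N"] by simp
next
  case (aligned M)
  then have al: "P (Suc t) j = R t j" if "t \<ge> M" "j \<noteq> c" for t j
    using that by blast
  obtain \<Psi> :: "'a \<Rightarrow> 'a \<Rightarrow> nat" where \<Psi>:
    "\<forall>p\<in>pverts (H c). \<forall>r\<in>pverts (H c). \<forall>r'\<in>closed_nbhd (H c) r.
       p \<noteq> r \<and> (r' = r \<or> (r, r') \<in> B) \<and> r' \<noteq> g p r \<and> (r \<noteq> r' \<longrightarrow> {p, g p r} \<noteq> {r, r'}) \<longrightarrow>
       \<Psi> (g p r) r' < \<Psi> p r"
    using assms(1) unfolding catches_def by (elim exE)
  \<comment> \<open>One round later the cop is aligned already before the move.\<close>
  define N' where "N' = Suc (max M N)"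
  have N': "Suc M \<le> N'" "Suc N \<le> N'"
    by (auto simp: N'_def)
  have off_eq: "R (Suc t) j = R t j" if "t \<ge> N" "j \<noteq> c" for t j
    using off[OF that(1)] that(2) by metis
  have pre: "P t j = R t j" if "t \<ge> N'" "j \<noteq> c" for t j
  proof -
    obtain s where s: "t = Suc s" "s \<ge> M" "s \<ge> N"
      using N' \<open>t \<ge> N'\<close> by (cases t) auto
    then show ?thesis
      using al[of s j] off_eq[of s j] that(2) by simp
  qed
  have step: "P (Suc t) = (P t)(c := g (P t c) (R t c))" if "t \<ge> N'" for t
    using align_then_on[of "P t" "R t"] pre[OF that] P_Suc by simp
  have less: "\<Psi> (P (Suc t) c) (R (Suc t) c) < \<Psi> (P t c) (R t c)" if "t \<ge> N'" for t
  proof -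
    have tN: "t \<ge> N" "t \<ge> M"
      using that N' by auto
    have sucs: "\<And>j. j \<noteq> c \<Longrightarrow> P (Suc t) j = R (Suc t) j" "\<And>j. j \<noteq> c \<Longrightarrow> P t j = R t j"
      "\<And>j. j \<noteq> c \<Longrightarrow> R (Suc t) j = R t j"
      using pre[of t] pre[of "Suc t"] off_eq tN that by auto
    have g: "g (P t c) (R t c) = P (Suc t) c"
      using step[OF that] by simp
    have ne: "P t c \<noteq> R t c"
    proof -
      obtain s where s: "t = Suc s"
        using N' \<open>t \<ge> N'\<close> by (cases t) auto
      then show ?thesis
        using not_hit[of s] sucs(2) eq_by_coordinate[of c "P t" "R t"] by metis
    qed
    have ne': "R (Suc t) c \<noteq> g (P t c) (R t c)"
      using not_hit[of t] sucs(1) g eq_by_coordinate[of c "P (Suc t)" "R (Suc t)"] by metis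
    have cr: "{P t c, g (P t c) (R t c)} \<noteq> {R t c, R (Suc t) c}" if "R t c \<noteq> R (Suc t) c"
    proof
      assume "{P t c, g (P t c) (R t c)} = {R t c, R (Suc t) c}"
      then have "P t c = R (Suc t) c \<and> P (Suc t) c = R t c"
        using ne g by (auto simp: doubleton_eq_iff)
      then have "P t = R (Suc t) \<and> P (Suc t) = R t"
        using sucs eq_by_coordinate[of c "P t" "R (Suc t)"] eq_by_coordinate[of c "P (Suc t)" "R t"]
        by metis
      then show False
        using not_crossed[of t] that by (metis insert_commute)
    qed
    have "P t c \<noteq> R t c \<and> (R (Suc t) c = R t c \<or> (R t c, R (Suc t) c) \<in> B) \<and>
        R (Suc t) c \<noteq> g (P t c) (R t c) \<and>
        (R t c \<noteq> R (Suc t) c \<longrightarrow> {P t c, g (P t c) (R t c)} \<noteq> {R t c, R (Suc t) c})"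
      using ne ne' cr on[OF tN(1)] by simp
    from \<Psi>[rule_format, OF coordinate_in R_step_c this] show ?thesis
      unfolding g .
  qed
  obtain L where L: "L \<ge> N'" "\<And>t. t \<ge> L \<Longrightarrow> \<Psi> (P t c) (R t c) = \<Psi> (P L c) (R L c)"
    using antimono_nat_eventually_const[of N' "\<lambda>t. \<Psi> (P t c) (R t c)"] less by (metis less_imp_le)
  show False
    using less[OF L(1)] L(2)[of "Suc L"] by simp
qed

end

text \<open>
  Cop \<open>0\<close> is the catcher. The other cops are guards; they have to guard every arc of every coordinate,
  except for the arcs in \<open>B\<close> in the catcher's coordinate. Then an uncaptured robot would eventually only
  stay put or move along \<open>B\<close>, and the catcher would get him.
\<close>

lemma cops_win_product:
  fixes H :: "'i \<Rightarrow> 'a pair_pre_digraph" and c :: "nat \<Rightarrow> 'i"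
  assumes "finite I" and conn: "\<And>i. i \<in> I \<Longrightarrow> conn_graph (H i)"
    and "0 < n" and c_in: "\<And>\<kappa>. \<kappa> < n \<Longrightarrow> c \<kappa> \<in> I"
    and g_closed: "\<And>\<kappa> p r. \<kappa> < n \<Longrightarrow> p \<in> pverts (H (c \<kappa>)) \<Longrightarrow> r \<in> pverts (H (c \<kappa>)) \<Longrightarrow>
           g \<kappa> p r \<in> closed_nbhd (H (c \<kappa>)) p"
    and guards: "\<And>\<kappa>. 0 < \<kappa> \<Longrightarrow> \<kappa> < n \<Longrightarrow> guards (H (c \<kappa>)) (g \<kappa>) (A \<kappa>)"
    and catches: "catches (H (c 0)) (g 0) B"
    and cover: "\<And>i x y. i \<in> I \<Longrightarrow> (x, y) \<in> parcs (H i) \<Longrightarrow>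
           i = c 0 \<and> (x, y) \<in> B \<or> (\<exists>\<kappa>. 0 < \<kappa> \<and> \<kappa> < n \<and> c \<kappa> = i \<and> (x, y) \<in> A \<kappa>)"
  shows "cops_win (cartesian_product I H) n"
proof -
  let ?G = "cartesian_product I H"
  define x0 where "x0 = (\<lambda>i\<in>I. SOME x. x \<in> pverts (H i))"
  have x0: "x0 \<in> (\<Pi>\<^sub>E i\<in>I. pverts (H i))"
    using conn by (auto simp: x0_def conn_graph_def some_in_eq)
  \<comment> \<open>Each cop's answer depends on the current positions only, so his position is a fold over the history.\<close>
  define S :: "('i \<Rightarrow> 'a) cop_strategy"
    where "S = (\<lambda>h \<kappa>. foldl (align_then I H (c \<kappa>) (g \<kappa>)) x0 h)"
  have pos_0: "cop_pos S R 0 \<kappa> = x0" for R \<kappa>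
    by (simp add: cop_pos_def S_def)
  have pos_Suc: "cop_pos S R (Suc t) \<kappa> = align_then I H (c \<kappa>) (g \<kappa>) (cop_pos S R t \<kappa>) (R t)" for R t \<kappa>
    by (simp add: cop_pos_def S_def)
  have R_in: "R t \<in> (\<Pi>\<^sub>E i\<in>I. pverts (H i))" if "robot_play ?G R" for R t
  proof (induction t)
    case (Suc t)
    then show ?case
      using that closed_nbhd_product_in unfolding robot_play_def by blast
  qed (use that in \<open>simp add: robot_play_def\<close>)
  have step: "cop_pos S R (Suc t) \<kappa> \<in> closed_nbhd ?G (cop_pos S R t \<kappa>)"
    if "robot_play ?G R" "\<kappa> < n" "cop_pos S R t \<kappa> \<in> (\<Pi>\<^sub>E i\<in>I. pverts (H i))" for R t \<kappa>
    unfolding pos_Suc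
    by (intro align_then_closed_nbhd conn c_in g_closed R_in that)
  have pos_in: "cop_pos S R t \<kappa> \<in> (\<Pi>\<^sub>E i\<in>I. pverts (H i))" if "robot_play ?G R" "\<kappa> < n" for R t \<kappa>
  proof (induction t)
    case (Suc t)
    then show ?case
      using closed_nbhd_product_in[OF Suc step[OF that Suc]] by blast
  qed (simp add: pos_0 x0)
  have "legal_strategy ?G n S"
    unfolding legal_strategy_def using x0 step pos_in by (auto simp: S_def)
  moreover have "\<exists>t. captured_in_round n S R t" if play: "robot_play ?G R" for R
  proof (rule ccontr)
    assume "\<nexists>t. captured_in_round n S R t"
    then have chase: "product_chase I H (c \<kappa>) (g \<kappa>) (\<lambda>t. cop_pos S R t \<kappa>) R" if "\<kappa> < n" for \<kappa>
      unfolding captured_in_round_def using that assms(1) play x0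
      by unfold_locales (auto simp: pos_0 pos_Suc intro: conn c_in g_closed)
    have "\<exists>N. \<forall>t\<ge>N. R t (c \<kappa>) = R (Suc t) (c \<kappa>) \<or> (R t (c \<kappa>), R (Suc t) (c \<kappa>)) \<notin> A \<kappa>"
      if "0 < \<kappa>" "\<kappa> < n" for \<kappa>
      using product_chase.guards_finitely_many_moves[OF chase guards] that by blast
    then obtain N where N: "\<And>\<kappa> t. 0 < \<kappa> \<Longrightarrow> \<kappa> < n \<Longrightarrow> t \<ge> N \<kappa> \<Longrightarrow>
        R t (c \<kappa>) = R (Suc t) (c \<kappa>) \<or> (R t (c \<kappa>), R (Suc t) (c \<kappa>)) \<notin> A \<kappa>"
      by metis
    define M where "M = Max (N ` {..<n})"
    have M: "N \<kappa> \<le> M" if "\<kappa> < n" for \<kappa>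
      using that by (auto simp: M_def)
    have late: "R (Suc t) i = R t i \<or> i = c 0 \<and> (R t i, R (Suc t) i) \<in> B" if "t \<ge> M" for t i
    proof -
      have "R (Suc t) \<in> closed_nbhd ?G (R t)"
        using play by (simp add: robot_play_def)
      then show ?thesis
      proof (cases rule: closed_nbhd_product_cases)
        case (move j)
        show ?thesis
        proof (cases "i = j")
          case True
          then show ?thesis
            using cover[OF move(1,2)] move(3) N M that by (metis le_trans)
        next
          case False
          then show ?thesis using move(4) by simp
        qed
      qed simp
    qed
    show False
      by (rule product_chase.catches_captures[OF chase[OF \<open>0 < n\<close>] catches, of M]) (use late in metis)+
  qed
  ultimately show ?thesis
    unfolding cops_win_def by blast
qed

section \<open>Lower bound by the minimum degree\<close>

lemma c_cr_eqI:
  assumes "cops_win G n" "\<And>r. r < n \<Longrightarrow> \<not> cops_win G r"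
  shows "c_cr G = n"
  unfolding c_cr_def using assms by (intro Least_equality) (auto simp: not_less[symmetric])

text \<open>
  In a round each cop can block at most one neighbour \<open>w\<close> of the robot's vertex \<open>v\<close>: the vertex where he
  stands, or the one from which he has just come if he stands on \<open>v\<close>. So with \<open>r\<close> cops and more than
  \<open>r\<close> neighbours the robot always has a free neighbour to move to.
\<close>

lemma not_cops_win:
  assumes ne: "pverts G \<noteq> {}"
    and arcs: "parcs G \<subseteq> pverts G \<times> pverts G"
    and deg: "\<And>v. v \<in> pverts G \<Longrightarrow> \<exists>W. finite W \<and> r < card W \<and> (\<forall>w\<in>W. w \<noteq> v \<and> (v, w) \<in> parcs G)"
  shows "\<not> cops_win G r"
proof
  assume "cops_win G r"
  then obtain S where win: "\<And>R. robot_play G R \<Longrightarrow> \<exists>t. captured_in_round r S R t"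
    unfolding cops_win_def by blast
  \<comment> \<open>The cops have moved from \<open>a\<close> to \<open>b\<close>; the robot can move from \<open>v\<close> to \<open>w\<close> without being captured.\<close>
  define safe where "safe a b v w \<longleftrightarrow>
    (v, w) \<in> parcs G \<and> w \<noteq> v \<and> (\<forall>i<r. b i \<noteq> w \<and> {a i, b i} \<noteq> {v, w})" for a b :: "nat \<Rightarrow> 'a" and v w
  have ex_safe: "\<exists>w. safe a b v w" if v: "v \<in> pverts G" for a b v
  proof -
    obtain W where W: "finite W" "r < card W" "\<And>w. w \<in> W \<Longrightarrow> w \<noteq> v \<and> (v, w) \<in> parcs G"
      using deg[OF v] by blast
    define F where "F = (\<lambda>i. if b i = v then a i else b i) ` {..<r}"
    have "card F \<le> r"
      unfolding F_def by (rule order_trans[OF card_image_le]) simp_all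
    then have "\<not> W \<subseteq> F"
      using W(2) card_mono[of F W] by (auto simp: F_def)
    then obtain w where w: "w \<in> W" "w \<notin> F"
      by blast
    have "b i \<noteq> w \<and> {a i, b i} \<noteq> {v, w}" if "i < r" for i
    proof -
      have "(if b i = v then a i else b i) \<in> F"
        using that by (simp add: F_def)
      then have "w \<noteq> (if b i = v then a i else b i)"
        using w(2) by metis
      then show ?thesis
        using W(3)[OF w(1)] by (auto simp: doubleton_eq_iff split: if_splits)
    qed
    then have "safe a b v w"
      using W(3)[OF w(1)] by (simp add: safe_def)
    then show ?thesis ..
  qed
  obtain x0 where x0: "x0 \<in> pverts G"
    using ne by blast
  \<comment> \<open>The robot's positions so far, which is what a cop strategy sees.\<close>
  define hist where "hist = rec_nat [x0] (\<lambda>_ h. h @ [SOME w. safe (S (butlast h)) (S h) (last h) w])"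
  define R where "R t = last (hist t)" for t
  have hist_Suc: "hist (Suc t) = hist t @ [SOME w. safe (S (butlast (hist t))) (S (hist t)) (last (hist t)) w]" for t
    by (simp add: hist_def)
  have hist_map: "hist t = map R [0..<Suc t]" for t
  proof (induction t)
    case (Suc t)
    have "hist (Suc t) = hist t @ [R (Suc t)]"
      by (simp add: hist_Suc R_def)
    then show ?case using Suc by simp
  qed (simp add: R_def hist_def)
  have R_Suc: "R (Suc t) = (SOME w. safe (cop_pos S R t) (cop_pos S R (Suc t)) (R t) w)" for t
  proof -
    have "butlast (hist t) = map R [0..<t]" "last (hist t) = R t"
      by (simp_all add: hist_map)
    then show ?thesis
      unfolding R_def[of "Suc t"] hist_Suc cop_pos_def by (simp add: hist_map)
  qed
  have safe_R: "safe (cop_pos S R t) (cop_pos S R (Suc t)) (R t) (R (Suc t))" if "R t \<in> pverts G" for t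
    unfolding R_Suc by (rule someI_ex[OF ex_safe[OF that]])
  have R_in: "R t \<in> pverts G" for t
  proof (induction t)
    case (Suc t)
    then show ?case using safe_R[OF Suc] arcs by (auto simp: safe_def)
  qed (simp add: R_def hist_def x0)
  have "robot_play G R"
    using R_in safe_R by (auto simp: robot_play_def closed_nbhd_def safe_def)
  then obtain t where "captured_in_round r S R t"
    using win by blast
  then show False
    using safe_R[OF R_in, of t] by (auto simp: captured_in_round_def safe_def)
qed

lemma not_cops_win_0:
  assumes "pverts G \<noteq> {}"
  shows "\<not> cops_win G 0"
proof -
  obtain x where "x \<in> pverts G"
    using assms by blast
  then have "robot_play G (\<lambda>_. x)"
    by (simp add: robot_play_def closed_nbhd_def)
  then show ?thesis
    by (auto simp: cops_win_def captured_in_round_def)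
qed

lemma pverts_product_nonempty:
  assumes "\<And>i. i \<in> I \<Longrightarrow> conn_graph (H i)"
  shows "pverts (cartesian_product I H) \<noteq> {}"
proof -
  have "(\<lambda>i\<in>I. SOME x. x \<in> pverts (H i)) \<in> pverts (cartesian_product I H)"
    using assms by (auto simp: conn_graph_def some_in_eq)
  then show ?thesis by blast
qed

lemma not_cops_win_product:
  assumes "finite I" and conn: "\<And>i. i \<in> I \<Longrightarrow> conn_graph (H i)"
    and deg: "\<And>i x. i \<in> I \<Longrightarrow> x \<in> pverts (H i) \<Longrightarrow>
      \<exists>W. finite W \<and> card W = d \<and> (\<forall>w\<in>W. w \<noteq> x \<and> (x, w) \<in> parcs (H i))"
    and less: "r < d * card I"
  shows "\<not> cops_win (cartesian_product I H) r"
proof (rule not_cops_win)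
  let ?G = "cartesian_product I H"
  show "pverts ?G \<noteq> {}"
    by (rule pverts_product_nonempty[OF conn])
  show "parcs ?G \<subseteq> pverts ?G \<times> pverts ?G"
    by (auto simp: cartesian_product_def)
  fix v assume v: "v \<in> pverts ?G"
  have "\<exists>W. finite W \<and> card W = d \<and> (\<forall>w\<in>W. w \<noteq> v i \<and> (v i, w) \<in> parcs (H i))" if "i \<in> I" for i
    using deg[OF that, of "v i"] v that by (simp add: PiE_iff)
  then obtain W where W: "\<And>i. i \<in> I \<Longrightarrow> finite (W i)" "\<And>i. i \<in> I \<Longrightarrow> card (W i) = d"
    "\<And>i w. i \<in> I \<Longrightarrow> w \<in> W i \<Longrightarrow> w \<noteq> v i \<and> (v i, w) \<in> parcs (H i)"
    by metis
  define U where "U = (\<lambda>(i, w). v(i := w)) ` (SIGMA i:I. W i)"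
  have "inj_on (\<lambda>(i, w). v(i := w)) (SIGMA i:I. W i)"
  proof (rule inj_onI, clarsimp)
    fix i w j u
    assume iw: "i \<in> I" "w \<in> W i" "j \<in> I" "u \<in> W j" and eq: "v(i := w) = v(j := u)"
    have "i = j"
    proof (rule ccontr)
      assume "i \<noteq> j"
      then have "w = v i"
        using fun_cong[OF eq, of i] by simp
      then show False using W(3)[OF iw(1,2)] by simp
    qed
    then show "i = j \<and> w = u"
      using fun_cong[OF eq, of i] by simp
  qed
  then have "card U = card (SIGMA i:I. W i)"
    unfolding U_def by (rule card_image)
  also have "\<dots> = d * card I"
    using assms(1) W(1,2) by simp
  finally have "card U = d * card I" .
  moreover have "finite U"
    unfolding U_def using assms(1) W(1) by blast
  moreover have "u \<noteq> v \<and> (v, u) \<in> parcs ?G" if u: "u \<in> U" for u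
  proof -
    obtain i w where iw: "i \<in> I" "w \<in> W i" "u = v(i := w)"
      using u by (auto simp: U_def)
    note w = W(3)[OF iw(1,2)]
    have "u \<in> closed_nbhd ?G v"
      unfolding iw(3) by (rule fun_upd_closed_nbhd_product[OF conn])
        (use v iw(1) w in \<open>auto simp: closed_nbhd_def\<close>)
    moreover have "u i \<noteq> v i"
      using iw(3) w by simp
    then have "u \<noteq> v" by metis
    ultimately show ?thesis
      by (simp add: closed_nbhd_def)
  qed
  ultimately show "\<exists>W. finite W \<and> r < card W \<and> (\<forall>w\<in>W. w \<noteq> v \<and> (v, w) \<in> parcs ?G)"
    using less by metis
qed

section \<open>Trees\<close>

lemma tree_graph_conn:
  assumes "tree_graph H"
  shows "conn_graph H" and "sym (parcs H)" and "\<And>x. (x, x) \<notin> parcs H" and "finite (pverts H)"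
proof -
  interpret pair_graph H
    using assms by (simp add: tree_graph_def)
  have con: "connected (with_proj H)"
    using assms by (simp add: tree_graph_def)
  show s: "sym (parcs H)"
    using pair_sym_arcs by (simp add: symmetric_def)
  show "(x, x) \<notin> parcs H" for x
    using pair_no_loops[of "(x, x)"] by auto
  show "finite (pverts H)"
    by (rule pair_finite_verts)
  have sc: "strongly_connected (with_proj H)"
    using symmetric_connected_imp_strongly_connected[OF pair_sym_arcs con] .
  have "(u, v) \<in> (parcs H)\<^sup>*" if "u \<in> pverts H" "v \<in> pverts H" for u v
  proof -
    have "reachable (with_proj H) u v"
      using sc that by (simp add: strongly_connected_def)
    from reachable_rtranclI[OF this] show ?thesis by simp
  qed
  moreover have "pverts H \<noteq> {}"
    using sc by (simp add: strongly_connected_def)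
  ultimately show "conn_graph H"
    unfolding conn_graph_def using in_arcsD1 in_arcsD2 by auto
qed

text \<open>The arcs that remain when the vertex \<open>p\<close> is deleted.\<close>

definition arcs_avoiding :: "'a pair_pre_digraph \<Rightarrow> 'a \<Rightarrow> 'a rel" where
  "arcs_avoiding H p = {(x, y) \<in> parcs H. x \<noteq> p \<and> y \<noteq> p}"

text \<open>The component of \<open>r\<close> in \<open>H - p\<close>, for \<open>p \<noteq> r\<close>.\<close>

definition branch :: "'a pair_pre_digraph \<Rightarrow> 'a \<Rightarrow> 'a \<Rightarrow> 'a set" where
  "branch H p r = {v. (r, v) \<in> (arcs_avoiding H p)\<^sup>*}"

lemma pawalk_verts_snoc:
  "pcas u xs v \<Longrightarrow> pawalk_verts u (xs @ [(v, w)]) = pawalk_verts u xs @ [w]"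
  by (induction xs arbitrary: u) auto

lemma awalk_with_proj_iff:
  "pre_digraph.awalk (with_proj H) u xs v \<longleftrightarrow> u \<in> pverts H \<and> set xs \<subseteq> parcs H \<and> pcas u xs v"
  by (simp add: pre_digraph.awalk_def cas_with_proj_eq)

lemma pcas_snoc: "pcas u xs v \<Longrightarrow> pcas u (xs @ [(v, w)]) w"
  by (induction xs arbitrary: u) auto

text \<open>
  Two distinct neighbours \<open>q\<close>, \<open>q'\<close> of \<open>p\<close> in the same component of \<open>H - p\<close> would give a cycle: a path
  from \<open>q\<close> to \<open>q'\<close> that avoids \<open>p\<close>, closed up through \<open>p\<close>.
\<close>

lemma tree_unique_neighbour_in_branch:
  assumes tree: "tree_graph H" and pq: "(p, q) \<in> parcs H" and pq': "(p, q') \<in> parcs H"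
    and "q' \<in> branch H p q"
  shows "q' = q"
proof (rule ccontr)
  assume ne: "q' \<noteq> q"
  note con = tree_graph_conn[OF tree]
  have sub: "parcs H \<subseteq> pverts H \<times> pverts H"
    using con(1) by (simp add: conn_graph_def)
  define K where "K = \<lparr>pverts = pverts H - {p}, parcs = arcs_avoiding H p\<rparr>"
  interpret K: pair_wf_digraph K
    by unfold_locales (use sub in \<open>auto simp: K_def arcs_avoiding_def\<close>)
  have q: "q \<in> pverts K"
    using pq sub con(3) by (auto simp: K_def)
  have "(q, q') \<in> (parcs K)\<^sup>*"
    using assms(4) by (simp add: branch_def K_def)
  then have "reachable (with_proj K) q q'"
  proof (induction rule: rtrancl_induct)
    case base
    then show ?case using q by auto
  next
    case (step y z)
    then show ?case using K.reachable_adj_trans by simp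
  qed
  then obtain xs where "K.apath q xs q'"
    using K.reachable_apath by auto
  then have xs: "set xs \<subseteq> parcs K" "pcas q xs q'" "distinct (pawalk_verts q xs)"
    by (simp_all add: K.apath_def awalk_with_proj_iff)
  have verts: "set (pawalk_verts u zs) \<subseteq> pverts K" if "u \<in> pverts K" "set zs \<subseteq> parcs K" for u zs
    using that
  proof (induction zs arbitrary: u)
    case (Cons e zs)
    then show ?case
      using K.arc_fst_in_verts K.arc_snd_in_verts by simp
  qed simp
  then have p: "p \<notin> set (pawalk_verts q xs)"
    using q xs(1) by (auto simp: K_def)
  let ?c = "(p, q) # xs @ [(q', p)]"
  have "xs \<noteq> []"
    using xs(2) ne by auto
  then have "3 \<le> length ?c"
    by (cases xs) auto
  moreover have "pre_digraph.cycle (with_proj H) ?c"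
    unfolding pre_digraph.cycle_def awalk_with_proj_iff awalk_verts_with_proj_eq
  proof (intro exI[of _ p] conjI)
    show "p \<in> pverts H"
      using pq sub by auto
    show "set ?c \<subseteq> parcs H"
      using pq symD[OF con(2) pq'] xs(1) by (auto simp: K_def arcs_avoiding_def)
    show "pcas p ?c p"
      using pcas_snoc[OF xs(2)] by simp
    show "distinct (tl (pawalk_verts p ?c))"
      using xs(3) p by (simp add: pawalk_verts_snoc[OF xs(2)])
  qed simp
  ultimately show False
    using tree unfolding tree_graph_def by blast
qed

lemma branch_self: "r \<in> branch H p r"
  by (simp add: branch_def)

lemma branch_avoids:
  assumes "r \<noteq> p" "v \<in> branch H p r"
  shows "v \<noteq> p"
proof -
  have "(r, v) \<in> (arcs_avoiding H p)\<^sup>*"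
    using assms(2) by (simp add: branch_def)
  then show ?thesis
    by (induction rule: rtrancl_induct) (use assms(1) in \<open>auto simp: arcs_avoiding_def\<close>)
qed

lemma branch_subset_pverts:
  assumes "conn_graph H" "r \<in> pverts H"
  shows "branch H p r \<subseteq> pverts H"
proof
  fix v assume "v \<in> branch H p r"
  then have "(r, v) \<in> (arcs_avoiding H p)\<^sup>*"
    by (simp add: branch_def)
  then show "v \<in> pverts H"
    by (induction rule: rtrancl_induct)
      (use assms in \<open>auto simp: arcs_avoiding_def conn_graph_def\<close>)
qed

lemma branch_step:
  assumes "r \<noteq> p" "r' \<noteq> p" "r' \<in> closed_nbhd H r"
  shows "r' \<in> branch H p r" and "branch H p r' \<subseteq> branch H p r"
proof -
  show *: "r' \<in> branch H p r"
    using assms by (auto simp: branch_def closed_nbhd_def arcs_avoiding_def)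
  show "branch H p r' \<subseteq> branch H p r"
    using * by (auto simp: branch_def)
qed

lemma branch_sym:
  assumes "sym (parcs H)" "v \<in> branch H p r"
  shows "r \<in> branch H p v"
proof -
  have "sym (arcs_avoiding H p)"
    using assms(1) by (auto simp: sym_def arcs_avoiding_def)
  then show ?thesis
    using assms(2) sym_rtrancl symD unfolding branch_def mem_Collect_eq by metis
qed

text \<open>A neighbour of \<open>p\<close> in the branch at \<open>p\<close> that contains \<open>r\<close>; in a tree it is unique.\<close>

definition gate :: "'a pair_pre_digraph \<Rightarrow> 'a \<Rightarrow> 'a \<Rightarrow> 'a" where
  "gate H p r = (SOME q. (p, q) \<in> parcs H \<and> q \<in> branch H p r)"

lemma gate:
  assumes "conn_graph H" "sym (parcs H)" "p \<in> pverts H" "r \<in> pverts H" "p \<noteq> r"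
  shows "(p, gate H p r) \<in> parcs H" and "gate H p r \<in> branch H p r"
proof -
  have "(r, p) \<in> (parcs H)\<^sup>*"
    using assms by (simp add: conn_graph_def)
  then have "p \<noteq> p \<and> p \<in> branch H p r \<or> (\<exists>q. (q, p) \<in> parcs H \<and> q \<in> branch H p r)"
  proof (induction rule: rtrancl_induct[where P = "\<lambda>v. v \<noteq> p \<and> v \<in> branch H p r \<or>
      (\<exists>q. (q, p) \<in> parcs H \<and> q \<in> branch H p r)"])
    case base
    then show ?case using assms(5) branch_self[of r H p] by auto
  next
    case (step y z)
    show ?case
    proof (cases "z = p")
      case True
      then show ?thesis using step by blast
    next
      case False
      then show ?thesis
        using step unfolding branch_def arcs_avoiding_def by (auto intro: rtrancl_into_rtrancl)
    qed
  qed
  then have "\<exists>q. (p, q) \<in> parcs H \<and> q \<in> branch H p r"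
    using symD[OF assms(2)] by blast
  from someI_ex[OF this] show "(p, gate H p r) \<in> parcs H" "gate H p r \<in> branch H p r"
    by (simp_all add: gate_def)
qed

lemma tree_neighbour_is_gate:
  assumes "tree_graph H" "p \<in> pverts H" "r \<in> pverts H" "p \<noteq> r" "(p, v) \<in> parcs H" "v \<in> branch H p r"
  shows "v = gate H p r"
proof -
  note con = tree_graph_conn[OF assms(1)]
  note g = gate[OF con(1,2) assms(2-4)]
  have "gate H p r \<in> branch H p v"
    using branch_sym[OF con(2) assms(6)] g(2) unfolding branch_def by auto
  then show ?thesis
    using tree_unique_neighbour_in_branch[OF assms(1,5) g(1)] by simp
qed

text \<open>
  When the cop steps from \<open>p\<close> to the gate towards the robot, the robot stays locked in: he could leave
  his old branch through \<open>p\<close> only, and the gate stands before it. His branch loses at least the gate.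
\<close>

lemma branch_shrinks:
  assumes tree: "tree_graph H" and p: "p \<in> pverts H" and r: "r \<in> pverts H" and pr: "p \<noteq> r"
    and r': "r' \<in> closed_nbhd H r" "r' \<noteq> gate H p r" "\<not> (r = gate H p r \<and> r' = p)"
  shows "card (branch H (gate H p r) r') < card (branch H p r)"
proof -
  let ?q = "gate H p r"
  note con = tree_graph_conn[OF tree]
  note g = gate[OF con(1,2) p r pr]
  note uniq = tree_neighbour_is_gate[OF tree p r pr]
  have r'p: "r' \<noteq> p"
  proof
    assume "r' = p"
    then have "(p, r) \<in> parcs H"
      using r'(1) pr symD[OF con(2)] by (auto simp: closed_nbhd_def)
    then show False
      using uniq[of r] branch_self r'(3) \<open>r' = p\<close> by metis
  qed
  have base: "r' \<in> branch H p r"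
    using branch_step(1)[of r p r'] pr r'p r'(1) by simp
  have "v \<in> branch H p r" if "(r', v) \<in> (arcs_avoiding H ?q)\<^sup>*" for v
    using that
  proof (induction rule: rtrancl_induct)
    case (step v w)
    have vw: "(v, w) \<in> parcs H" "v \<noteq> ?q"
      using step(2) by (auto simp: arcs_avoiding_def)
    have "v \<noteq> p"
      using branch_avoids step(3) pr by metis
    moreover have "w \<noteq> p"
      using uniq[of v] vw symD[OF con(2)] step(3) by metis
    ultimately have "(v, w) \<in> arcs_avoiding H p"
      using vw by (simp add: arcs_avoiding_def)
    then show ?case
      using step(3) unfolding branch_def by (auto intro: rtrancl_into_rtrancl)
  qed (rule base)
  then have "branch H ?q r' \<subseteq> branch H p r"
    by (auto simp: branch_def)
  moreover have "?q \<notin> branch H ?q r'"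
    using branch_avoids r'(2) by metis
  ultimately have "branch H ?q r' \<subset> branch H p r"
    using g(2) by blast
  moreover have "finite (branch H p r)"
    using branch_subset_pverts[OF con(1) r] con(4) finite_subset by blast
  ultimately show ?thesis
    by (simp add: psubset_card_mono)
qed

text \<open>The catcher on a tree always steps towards the robot.\<close>

definition tree_chase :: "'a pair_pre_digraph \<Rightarrow> 'a \<Rightarrow> 'a \<Rightarrow> 'a" where
  "tree_chase H p r = (if p = r then p else gate H p r)"

text \<open>
  The guard on a tree steps towards the robot until he is adjacent to him and then waits. He never steps
  onto the robot, since the robot could then leave towards the guard's former vertex after a move
  in some other coordinate.
\<close>

definition tree_guard :: "'a pair_pre_digraph \<Rightarrow> 'a \<Rightarrow> 'a \<Rightarrow> 'a" where
  "tree_guard H p r = (if p = r \<or> (p, r) \<in> parcs H then p else gate H p r)"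

lemma tree_moves_closed_nbhd:
  assumes "tree_graph H" "p \<in> pverts H" "r \<in> pverts H"
  shows "tree_chase H p r \<in> closed_nbhd H p" and "tree_guard H p r \<in> closed_nbhd H p"
  using gate(1)[OF tree_graph_conn(1,2)[OF assms(1)] assms(2,3)]
  by (auto simp: tree_chase_def tree_guard_def closed_nbhd_def)

lemma tree_chase_catches:
  assumes "tree_graph H"
  shows "catches H (tree_chase H) (parcs H)"
  unfolding catches_def
proof (intro exI[of _ "\<lambda>p r. card (branch H p r)"] ballI impI)
  fix p r r'
  assume p: "p \<in> pverts H" and r: "r \<in> pverts H" and r': "r' \<in> closed_nbhd H r"
    and *: "p \<noteq> r \<and> (r' = r \<or> (r, r') \<in> parcs H) \<and> r' \<noteq> tree_chase H p r \<and>
      (r \<noteq> r' \<longrightarrow> {p, tree_chase H p r} \<noteq> {r, r'})"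
  then have c: "tree_chase H p r = gate H p r"
    by (simp add: tree_chase_def)
  have "\<not> (r = gate H p r \<and> r' = p)"
  proof
    assume eq: "r = gate H p r \<and> r' = p"
    then have "{p, tree_chase H p r} = {r, r'}"
      using c by auto
    then show False using * eq by auto
  qed
  then show "card (branch H (tree_chase H p r) r') < card (branch H p r)"
    using branch_shrinks[OF assms p r _ r'] * c by simp
qed

lemma tree_guard_guards:
  assumes tree: "tree_graph H"
  shows "guards H (tree_guard H) (parcs H)"
proof -
  note con = tree_graph_conn[OF tree]
  \<comment> \<open>Doubling the branch size leaves room for the move by which the robot runs up to a waiting guard: it
    keeps the branch but makes the two adjacent. The value for \<open>p = r\<close> exceeds all values that can follow.\<close>
  define \<Phi> where "\<Phi> p r = (if p = r then 2 * card (pverts H) + 1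
      else 2 * card (branch H p r) + (if (p, r) \<in> parcs H then 0 else 1))" for p r
  have fin: "finite (branch H p r)" if "r \<in> pverts H" for p r
    using branch_subset_pverts[OF con(1) that] con(4) finite_subset by blast
  have le: "card (branch H p r) \<le> card (pverts H)" if "r \<in> pverts H" for p r
    using branch_subset_pverts[OF con(1) that] con(4) by (simp add: card_mono)
  have "\<Phi> (tree_guard H p r') r' \<le> \<Phi> p r \<and>
      (r \<noteq> r' \<and> (r, r') \<in> parcs H \<longrightarrow> \<Phi> (tree_guard H p r') r' < \<Phi> p r)"
    if p: "p \<in> pverts H" and r: "r \<in> pverts H" and r': "r' \<in> closed_nbhd H r" and ne: "r' \<noteq> p"
    for p r r'
  proof -
    have r'_in: "r' \<in> pverts H"
      using closed_nbhd_in_pverts[OF con(1) r r'] .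
    consider (start) "p = r" | (near) "p \<noteq> r" "(p, r') \<in> parcs H" | (far) "p \<noteq> r" "(p, r') \<notin> parcs H"
      by blast
    then show ?thesis
    proof cases
      case start
      then have "(p, r') \<in> parcs H"
        using r' ne by (auto simp: closed_nbhd_def)
      then show ?thesis
        using start ne le[OF r'_in, of p] by (simp add: \<Phi>_def tree_guard_def)
    next
      case near
      have mono: "card (branch H p r') \<le> card (branch H p r)"
        using branch_step(2)[of r p r'] near(1) ne r' fin[OF r] by (simp add: card_mono)
      have "r = r'" if "(p, r) \<in> parcs H"
      proof -
        have "r' \<in> branch H p r"
          using branch_step(1)[of r p r'] near(1) ne r' by simp
        then show ?thesis
          using tree_unique_neighbour_in_branch[OF tree that near(2)] by simp
      qed
      then show ?thesis
        using near ne mono by (auto simp: \<Phi>_def tree_guard_def)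
    next
      case far
      let ?q = "gate H p r'"
      have pr': "p \<noteq> r'" using ne by simp
      have q: "(p, ?q) \<in> parcs H"
        using gate(1)[OF con(1,2) p r'_in pr'] .
      then have "r' \<noteq> ?q" using far(2) by metis
      then have "card (branch H ?q r') < card (branch H p r')"
        by (intro branch_shrinks[OF tree p r'_in pr']) (auto simp: closed_nbhd_def)
      also have "\<dots> \<le> card (branch H p r)"
        using branch_step(2)[of r p r'] far(1) ne r' fin[OF r] by (simp add: card_mono)
      finally show ?thesis
        using \<open>r' \<noteq> ?q\<close> far ne by (auto simp: \<Phi>_def tree_guard_def)
    qed
  qed
  then show ?thesis
    unfolding guards_def by blast
qed

lemma tree_graph_has_neighbour:
  assumes "tree_graph H" "2 \<le> card (pverts H)" "x \<in> pverts H"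
  shows "\<exists>W. finite W \<and> card W = 1 \<and> (\<forall>w\<in>W. w \<noteq> x \<and> (x, w) \<in> parcs H)"
proof -
  note con = tree_graph_conn[OF assms(1)]
  have "\<exists>y\<in>pverts H. x \<noteq> y"
  proof (rule ccontr)
    assume "\<not> (\<exists>y\<in>pverts H. x \<noteq> y)"
    then have "pverts H \<subseteq> {x}" by auto
    then have "card (pverts H) \<le> 1"
      using card_mono[of "{x}"] by simp
    then show False using assms(2) by simp
  qed
  then obtain y where y: "y \<in> pverts H" "x \<noteq> y"
    by blast
  then have "(x, gate H x y) \<in> parcs H"
    using gate(1)[OF con(1,2) assms(3)] by blast
  then show ?thesis
    using con(3) by (intro exI[of _ "{gate H x y}"]) auto
qed

text \<open>
  Cop \<open>\<kappa>\<close> is responsible for coordinate \<open>\<kappa> + 1\<close>. A single-vertex tree has no arcs, so for \<open>k = 1\<close> the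
  degree bound may fail, but one cop is needed in any case.
\<close>

lemma c_cr_product_trees:
  fixes T :: "nat \<Rightarrow> 'a pair_pre_digraph"
  assumes "1 \<le> k" and tree: "\<And>i. i \<in> {1..k} \<Longrightarrow> tree_graph (T i)"
    and big: "k = 1 \<or> (\<forall>i\<in>{1..k}. 2 \<le> card (pverts (T i)))"
  shows "c_cr (cartesian_product {1..k} T) = k"
proof (rule c_cr_eqI)
  have conn: "conn_graph (T i)" if "i \<in> {1..k}" for i
    using tree_graph_conn(1)[OF tree[OF that]] .
  show "cops_win (cartesian_product {1..k} T) k"
  proof (rule cops_win_product[where c = Suc and A = "\<lambda>\<kappa>. parcs (T (Suc \<kappa>))" and B = "parcs (T 1)"
        and g = "\<lambda>\<kappa>. if \<kappa> = 0 then tree_chase (T 1) else tree_guard (T (Suc \<kappa>))"])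
    show "(if \<kappa> = 0 then tree_chase (T 1) else tree_guard (T (Suc \<kappa>))) p r \<in> closed_nbhd (T (Suc \<kappa>)) p"
      if "\<kappa> < k" "p \<in> pverts (T (Suc \<kappa>))" "r \<in> pverts (T (Suc \<kappa>))" for \<kappa> p r
      using tree_moves_closed_nbhd[OF tree that(2,3)] that(1) by auto
    show "guards (T (Suc \<kappa>)) (if \<kappa> = 0 then tree_chase (T 1) else tree_guard (T (Suc \<kappa>))) (parcs (T (Suc \<kappa>)))"
      if "0 < \<kappa>" "\<kappa> < k" for \<kappa>
      using tree_guard_guards[OF tree] that by simp
    show "catches (T (Suc 0)) (if (0::nat) = 0 then tree_chase (T 1) else tree_guard (T (Suc 0))) (parcs (T 1))"
      using tree_chase_catches[OF tree, of 1] assms(1) by simp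
    show "i = Suc 0 \<and> (x, y) \<in> parcs (T 1) \<or> (\<exists>\<kappa>>0. \<kappa> < k \<and> Suc \<kappa> = i \<and> (x, y) \<in> parcs (T (Suc \<kappa>)))"
      if "i \<in> {1..k}" "(x, y) \<in> parcs (T i)" for i x y
    proof (cases "i = 1")
      case False
      then show ?thesis
        using that by (intro disjI2 exI[of _ "i - 1"]) auto
    qed (use that in simp)
  qed (use assms(1) conn in auto)
  show "\<not> cops_win (cartesian_product {1..k} T) r" if "r < k" for r
  proof (cases "k = 1")
    case True
    show ?thesis
      using not_cops_win_0[OF pverts_product_nonempty[of "{1..k}" T, OF conn]] True that by simp
  next
    case False
    then have "2 \<le> card (pverts (T i))" if "i \<in> {1..k}" for i
      using big that by blast
    then show ?thesis
      using conn tree_graph_has_neighbour[OF tree] \<open>r < k\<close>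
      by (intro not_cops_win_product[where d = 1]) auto
  qed
qed

section \<open>Cycles\<close>

text \<open>The vertices of the cycle \<open>H\<close> in cyclic order, with a chosen starting point and direction.\<close>

definition cyclic_enum :: "nat \<Rightarrow> (nat \<Rightarrow> 'a) \<Rightarrow> 'a pair_pre_digraph \<Rightarrow> bool" where
  "cyclic_enum m v H \<longleftrightarrow> 3 \<le> m \<and> bij_betw v {..<m} (pverts H) \<and>
     parcs H = (\<Union>i<m. {(v i, v (Suc i mod m)), (v (Suc i mod m), v i)})"

text \<open>The arcs that run against the direction of the enumeration.\<close>

definition backward_arcs :: "nat \<Rightarrow> (nat \<Rightarrow> 'a) \<Rightarrow> 'a rel" where
  "backward_arcs m v = {(v (Suc i mod m), v i) | i. i < m}"

text \<open>The number of forward steps from \<open>p\<close> to \<open>r\<close>, between \<open>0\<close> and \<open>m - 1\<close>.\<close>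

definition cyc_dist :: "nat \<Rightarrow> (nat \<Rightarrow> 'a) \<Rightarrow> 'a \<Rightarrow> 'a \<Rightarrow> nat" where
  "cyc_dist m v p r = (let i = the_inv_into {..<m} v p; j = the_inv_into {..<m} v r in
     if i \<le> j then j - i else j + m - i)"

definition cyc_succ :: "nat \<Rightarrow> (nat \<Rightarrow> 'a) \<Rightarrow> 'a \<Rightarrow> 'a" where
  "cyc_succ m v p = v (Suc (the_inv_into {..<m} v p) mod m)"

text \<open>
  Catcher and guard move forward only, each backward step of the robot being one towards them. The
  guard stops one step behind the robot.
\<close>

definition cyc_chase :: "nat \<Rightarrow> (nat \<Rightarrow> 'a) \<Rightarrow> 'a \<Rightarrow> 'a \<Rightarrow> 'a" where
  "cyc_chase m v p r = (if cyc_dist m v p r = 0 then p else cyc_succ m v p)"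

definition cyc_guard :: "nat \<Rightarrow> (nat \<Rightarrow> 'a) \<Rightarrow> 'a \<Rightarrow> 'a \<Rightarrow> 'a" where
  "cyc_guard m v p r = (if cyc_dist m v p r \<le> 1 then p else cyc_succ m v p)"

lemma Suc_mod_eq: "i < m \<Longrightarrow> Suc i mod m = (if Suc i = m then 0 else Suc i)"
  by auto

context
  fixes m :: nat and v :: "nat \<Rightarrow> 'a" and H :: "'a pair_pre_digraph"
  assumes enum: "cyclic_enum m v H"
begin

lemma m_ge: "3 \<le> m"
  using enum by (simp add: cyclic_enum_def)

lemma v_inj: "i < m \<Longrightarrow> j < m \<Longrightarrow> v i = v j \<longleftrightarrow> i = j"
  using enum by (auto simp: cyclic_enum_def bij_betw_def inj_on_def)

lemma v_in: "i < m \<Longrightarrow> v i \<in> pverts H"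
  using enum by (auto simp: cyclic_enum_def bij_betw_def)

lemma vertE:
  assumes "p \<in> pverts H"
  obtains i where "i < m" "p = v i"
  using assms enum by (auto simp: cyclic_enum_def bij_betw_def)

lemma index_v [simp]: "i < m \<Longrightarrow> the_inv_into {..<m} v (v i) = i"
  using enum by (auto simp: cyclic_enum_def bij_betw_def intro: the_inv_into_f_f)

lemma cyc_dist_v: "i < m \<Longrightarrow> j < m \<Longrightarrow> cyc_dist m v (v i) (v j) = (if i \<le> j then j - i else j + m - i)"
  by (simp add: cyc_dist_def)

lemma cyc_succ_v: "i < m \<Longrightarrow> cyc_succ m v (v i) = v (if Suc i = m then 0 else Suc i)"
  by (auto simp: cyc_succ_def)

lemma arc_v_iff:
  assumes "i < m" "j < m"
  shows "(v i, v j) \<in> parcs H \<longleftrightarrow> j = (if Suc i = m then 0 else Suc i) \<or> i = (if Suc j = m then 0 else Suc j)"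
proof -
  have "(v i, v j) \<in> parcs H \<longleftrightarrow> (\<exists>l<m. v i = v l \<and> v j = v (Suc l mod m) \<or> v i = v (Suc l mod m) \<and> v j = v l)"
    using enum by (auto simp: cyclic_enum_def)
  also have "\<dots> \<longleftrightarrow> (\<exists>l<m. i = l \<and> j = Suc l mod m \<or> i = Suc l mod m \<and> j = l)"
    using assms by (intro ex_cong1 conj_cong refl) (simp_all add: v_inj)
  also have "\<dots> \<longleftrightarrow> j = Suc i mod m \<or> i = Suc j mod m"
    using assms by auto
  finally show ?thesis
    using assms by (simp add: Suc_mod_eq)
qed

lemma backward_v_iff:
  assumes "i < m" "j < m"
  shows "(v i, v j) \<in> backward_arcs m v \<longleftrightarrow> i = (if Suc j = m then 0 else Suc j)"
proof -
  have "(v i, v j) \<in> backward_arcs m v \<longleftrightarrow> (\<exists>l<m. v i = v (Suc l mod m) \<and> v j = v l)"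
    by (auto simp: backward_arcs_def)
  also have "\<dots> \<longleftrightarrow> (\<exists>l<m. i = Suc l mod m \<and> j = l)"
    using assms by (intro ex_cong1 conj_cong refl) (simp_all add: v_inj)
  finally show ?thesis
    using assms by (simp add: Suc_mod_eq)
qed

lemma parcs_subset: "parcs H \<subseteq> pverts H \<times> pverts H"
  using enum v_in by (fastforce simp: cyclic_enum_def)

lemma nbhd_v:
  assumes "j < m" "r' \<in> closed_nbhd H (v j)"
  obtains j' where "j' < m" "r' = v j'"
    "j' = j \<or> j' = (if Suc j = m then 0 else Suc j) \<or> j = (if Suc j' = m then 0 else Suc j')"
proof (cases "r' = v j")
  case True
  then show ?thesis using assms(1) that by blast
next
  case False
  then have arc: "(v j, r') \<in> parcs H"
    using assms(2) by (simp add: closed_nbhd_def)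
  then have "r' \<in> pverts H"
    using parcs_subset by auto
  then obtain j' where "j' < m" "r' = v j'"
    by (rule vertE)
  then show ?thesis
    using that arc arc_v_iff[OF assms(1)] by blast
qed

lemma cyclic_enum_conn: "conn_graph H"
proof -
  have up: "(v 0, v i) \<in> (parcs H)\<^sup>*" if "i < m" for i
    using that
  proof (induction i)
    case (Suc i)
    have "(v i, v (Suc i)) \<in> parcs H"
      using Suc.prems by (subst arc_v_iff) auto
    then show ?case
      using Suc by (meson Suc_lessD rtrancl.rtrancl_into_rtrancl)
  qed simp
  have "sym (parcs H)"
    using enum by (auto simp: cyclic_enum_def sym_def)
  then have down: "(v i, v 0) \<in> (parcs H)\<^sup>*" if "i < m" for i
    using up[OF that] sym_rtrancl symD by metis
  have "(p, r) \<in> (parcs H)\<^sup>*" if pr: "p \<in> pverts H" "r \<in> pverts H" for p r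
    using vertE[OF pr(1)] vertE[OF pr(2)] up down rtrancl_trans by metis
  moreover have "pverts H \<noteq> {}"
    using v_in[of 0] m_ge by auto
  ultimately show ?thesis
    using parcs_subset by (simp add: conn_graph_def)
qed

lemma cyc_moves_closed_nbhd:
  assumes "p \<in> pverts H"
  shows "cyc_chase m v p r \<in> closed_nbhd H p" and "cyc_guard m v p r \<in> closed_nbhd H p"
proof -
  obtain i where i: "i < m" "p = v i"
    using assms by (rule vertE)
  then have "(p, cyc_succ m v p) \<in> parcs H"
    using cyc_succ_v[OF i(1)] by (auto simp: arc_v_iff)
  then show "cyc_chase m v p r \<in> closed_nbhd H p" "cyc_guard m v p r \<in> closed_nbhd H p"
    by (simp_all add: cyc_chase_def cyc_guard_def closed_nbhd_def)
qed

text \<open>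
  The potential is the directed distance, except that distance \<open>0\<close> counts as \<open>m\<close>: from the common vertex
  the robot may step backward, which makes the directed distance \<open>m - 1\<close>.
\<close>

lemma cyc_guard_guards: "guards H (cyc_guard m v) (backward_arcs m v)"
proof -
  define \<Phi> where "\<Phi> p r = (if cyc_dist m v p r = 0 then m else cyc_dist m v p r)" for p r
  have "\<Phi> (cyc_guard m v p r') r' \<le> \<Phi> p r \<and>
      (r \<noteq> r' \<and> (r, r') \<in> backward_arcs m v \<longrightarrow> \<Phi> (cyc_guard m v p r') r' < \<Phi> p r)"
    if p: "p \<in> pverts H" and r: "r \<in> pverts H" and r': "r' \<in> closed_nbhd H r" and ne: "r' \<noteq> p"
    for p r r'
  proof -
    obtain i where i: "i < m" "p = v i" using p by (rule vertE)
    obtain j where j: "j < m" "r = v j" using r by (rule vertE)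
    obtain j' where j': "j' < m" "r' = v j'"
      "j' = j \<or> j' = (if Suc j = m then 0 else Suc j) \<or> j = (if Suc j' = m then 0 else Suc j')"
      using nbhd_v[OF j(1)] r' j(2) by metis
    have d: "cyc_dist m v p r = (if i \<le> j then j - i else j + m - i)"
      "cyc_dist m v p r' = (if i \<le> j' then j' - i else j' + m - i)"
      using i j j' by (simp_all add: cyc_dist_v)
    have b: "r \<noteq> r' \<and> (r, r') \<in> backward_arcs m v \<longleftrightarrow> j \<noteq> j' \<and> j = (if Suc j' = m then 0 else Suc j')"
      using j j' by (simp add: backward_v_iff v_inj)
    have i': "i \<noteq> j'" using ne i j' by auto
    define l where "l = (if Suc i = m then 0 else Suc i)"
    have l: "l < m" using i(1) by (simp add: l_def)
    have d': "cyc_dist m v (cyc_succ m v p) r' = (if l \<le> j' then j' - l else j' + m - l)"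
      using i j' l by (simp add: cyc_succ_v cyc_dist_v flip: l_def)
    show ?thesis
    proof (cases "cyc_dist m v p r' \<le> 1")
      case True
      then have "\<Phi> (cyc_guard m v p r') r' = cyc_dist m v p r'"
        using d i' i j' by (auto simp: \<Phi>_def cyc_guard_def split: if_splits)
      then show ?thesis
        unfolding b \<Phi>_def using True d i' i(1) j(1) j'(1,3) m_ge by (auto split: if_splits)
    next
      case False
      then have "\<Phi> (cyc_guard m v p r') r' = cyc_dist m v p r' - 1"
        using d d' i' i(1) j'(1) by (auto simp: \<Phi>_def cyc_guard_def l_def split: if_splits)
      then show ?thesis
        unfolding b \<Phi>_def using False d i' i(1) j(1) j'(1,3) m_ge by (auto split: if_splits)
    qed
  qed
  then show ?thesis
    unfolding guards_def by blast
qed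

lemma cyc_chase_catches: "catches H (cyc_chase m v) (backward_arcs m v)"
  unfolding catches_def
proof (intro exI[of _ "cyc_dist m v"] ballI impI)
  fix p r r'
  assume p: "p \<in> pverts H" and r: "r \<in> pverts H" and r': "r' \<in> closed_nbhd H r"
    and *: "p \<noteq> r \<and> (r' = r \<or> (r, r') \<in> backward_arcs m v) \<and> r' \<noteq> cyc_chase m v p r \<and>
      (r \<noteq> r' \<longrightarrow> {p, cyc_chase m v p r} \<noteq> {r, r'})"
  obtain i where i: "i < m" "p = v i" using p by (rule vertE)
  obtain j where j: "j < m" "r = v j" using r by (rule vertE)
  obtain j' where j': "j' < m" "r' = v j'"
    using nbhd_v[OF j(1)] r' j(2) by metis
  have d: "cyc_dist m v p r = (if i \<le> j then j - i else j + m - i)"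
    using i j by (simp add: cyc_dist_v)
  have ne: "i \<noteq> j" using * i j by auto
  define l where "l = (if Suc i = m then 0 else Suc i)"
  have l: "l < m" using i(1) by (simp add: l_def)
  have g: "cyc_chase m v p r = v l"
    using d ne i by (auto simp: cyc_chase_def cyc_succ_v l_def split: if_splits)
  have d': "cyc_dist m v (v l) r' = (if l \<le> j' then j' - l else j' + m - l)"
    using j' l by (simp add: cyc_dist_v)
  have bwd: "j' = j \<or> j = (if Suc j' = m then 0 else Suc j')"
    using * j j' by (auto simp: backward_v_iff v_inj)
  have "j' \<noteq> l" using * g j' by auto
  moreover have "\<not> (j = l \<and> j' = i)"
    using * g i j j' ne by auto
  ultimately show "cyc_dist m v (cyc_chase m v p r) r' < cyc_dist m v p r"
    unfolding g d d' using bwd ne i(1) j(1) j'(1) unfolding l_def by (auto split: if_splits)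
qed

text \<open>Backward arcs of the mirrored enumeration are forward arcs of the given one.\<close>

lemma cyc_rev: "cyclic_enum m (\<lambda>i. v (m - 1 - i)) H"
  and cyc_rev_cover: "parcs H \<subseteq> backward_arcs m v \<union> backward_arcs m (\<lambda>i. v (m - 1 - i))"
proof -
  let ?w = "\<lambda>i. v (m - 1 - i)"
  have mirror: "bij_betw (\<lambda>i. m - 1 - i) {..<m} {..<m}"
    by (rule bij_betwI[where g = "\<lambda>i. m - 1 - i"]) auto
  then have "bij_betw (v \<circ> (\<lambda>i. m - 1 - i)) {..<m} (pverts H)"
    using enum bij_betw_trans[OF mirror] by (auto simp: cyclic_enum_def)
  then have bij: "bij_betw ?w {..<m} (pverts H)"
    by (simp add: comp_def)
  have flip: "(v j, v (Suc j mod m)) = (?w (Suc i mod m), ?w i)"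
    if "i < m" "j = (if Suc i = m then m - 1 else m - 2 - i)" for i j
  proof (cases "Suc i = m")
    case False
    then have "Suc (m - 2 - i) = m - 1 - i"
      using that(1) by linarith
    then show ?thesis
      using that False by (auto simp: Suc_mod_eq)
  qed (use that m_ge in auto)
  have ex: "\<exists>i<m. (v j, v (Suc j mod m)) = (?w (Suc i mod m), ?w i)" if "j < m" for j
  proof -
    define i where "i = (if Suc j = m then m - 1 else m - 2 - j)"
    have "i < m" "j = (if Suc i = m then m - 1 else m - 2 - i)"
      using that m_ge by (auto simp: i_def)
    then show ?thesis using flip by blast
  qed
  have ex': "\<exists>j<m. (v j, v (Suc j mod m)) = (?w (Suc i mod m), ?w i)" if "i < m" for i
    using flip[OF that refl] that m_ge by (intro exI[of _ "if Suc i = m then m - 1 else m - 2 - i"]) auto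
  have "parcs H = (\<Union>i<m. {(v i, v (Suc i mod m)), (v (Suc i mod m), v i)})"
    using enum by (simp add: cyclic_enum_def)
  also have "\<dots> = (\<Union>i<m. {(?w i, ?w (Suc i mod m)), (?w (Suc i mod m), ?w i)})" (is "?A = ?B")
  proof
    show "?A \<subseteq> ?B"
    proof
      fix e assume "e \<in> ?A"
      then obtain j where "j < m" "e = (v j, v (Suc j mod m)) \<or> e = (v (Suc j mod m), v j)"
        by blast
      then show "e \<in> ?B" using ex[of j] by auto
    qed
    show "?B \<subseteq> ?A"
    proof
      fix e assume "e \<in> ?B"
      then obtain i where "i < m" "e = (?w i, ?w (Suc i mod m)) \<or> e = (?w (Suc i mod m), ?w i)"
        by blast
      moreover obtain j where "j < m" "(v j, v (Suc j mod m)) = (?w (Suc i mod m), ?w i)"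
        using ex'[OF calculation(1)] by blast
      ultimately have "j < m \<and> (e = (v j, v (Suc j mod m)) \<or> e = (v (Suc j mod m), v j))"
        by auto
      then show "e \<in> ?A" by blast
    qed
  qed
  finally show "cyclic_enum m ?w H"
    using bij m_ge by (simp add: cyclic_enum_def)
  show "parcs H \<subseteq> backward_arcs m v \<union> backward_arcs m ?w"
  proof
    fix e assume "e \<in> parcs H"
    then obtain j where "j < m" "e = (v j, v (Suc j mod m)) \<or> e = (v (Suc j mod m), v j)"
      using enum by (auto simp: cyclic_enum_def)
    then show "e \<in> backward_arcs m v \<union> backward_arcs m ?w"
      using ex[of j] unfolding backward_arcs_def by auto
  qed
qed

lemma cyclic_enum_two_neighbours:
  assumes "x \<in> pverts H"
  shows "\<exists>W. finite W \<and> card W = 2 \<and> (\<forall>w\<in>W. w \<noteq> x \<and> (x, w) \<in> parcs H)"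
proof -
  obtain i where i: "i < m" "x = v i"
    using assms by (rule vertE)
  define a where "a = (if Suc i = m then 0 else Suc i)"
  define b where "b = (if i = 0 then m - 1 else i - 1)"
  have ab: "a < m" "b < m" "a \<noteq> b" "a \<noteq> i" "b \<noteq> i"
    using i(1) m_ge by (auto simp: a_def b_def split: if_splits)
  have "(x, v a) \<in> parcs H" "(x, v b) \<in> parcs H"
    using i ab(1,2) m_ge by (auto simp: arc_v_iff a_def b_def)
  then show ?thesis
    using ab i by (intro exI[of _ "{v a, v b}"]) (auto simp: v_inj)
qed

end

text \<open>
  Cops \<open>2i\<close> and \<open>2i + 1\<close> are responsible for coordinate \<open>i + 1\<close>, one for each direction. Cop \<open>0\<close> is the
  catcher: the other cops leave the robot nothing but staying put and backward moves in the first
  coordinate, and both let cop \<open>0\<close> come nearer.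
\<close>

lemma c_cr_product_cycles:
  fixes C :: "nat \<Rightarrow> 'a pair_pre_digraph"
  assumes "1 \<le> l" and cyc: "\<And>j. j \<in> {1..l} \<Longrightarrow> cycle_graph (m j) (C j)"
  shows "c_cr (cartesian_product {1..l} C) = 2 * l"
proof (rule c_cr_eqI)
  have "\<forall>j\<in>{1..l}. \<exists>v. cyclic_enum (m j) v (C j)"
    using cyc by (auto simp: cycle_graph_def cyclic_enum_def)
  then obtain v where v: "\<And>j. j \<in> {1..l} \<Longrightarrow> cyclic_enum (m j) (v j) (C j)"
    by metis
  have conn: "conn_graph (C j)" if "j \<in> {1..l}" for j
    using cyclic_enum_conn[OF v[OF that]] .
  define c where "c \<kappa> = Suc (\<kappa> div 2)" for \<kappa> :: nat
  define w where "w \<kappa> = (if even \<kappa> then v (c \<kappa>) else (\<lambda>i. v (c \<kappa>) (m (c \<kappa>) - 1 - i)))" for \<kappa>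
  define g where "g \<kappa> = (if \<kappa> = 0 then cyc_chase (m 1) (w 0) else cyc_guard (m (c \<kappa>)) (w \<kappa>))" for \<kappa>
  have c_in: "c \<kappa> \<in> {1..l}" if "\<kappa> < 2 * l" for \<kappa>
    using that by (auto simp: c_def)
  have enum: "cyclic_enum (m (c \<kappa>)) (w \<kappa>) (C (c \<kappa>))" if "\<kappa> < 2 * l" for \<kappa>
    using v[OF c_in[OF that]] cyc_rev[OF v[OF c_in[OF that]]] by (simp add: w_def)
  have c0: "c 0 = 1" by (simp add: c_def)
  have l0: "0 < 2 * l" using assms(1) by simp
  show "cops_win (cartesian_product {1..l} C) (2 * l)"
  proof (rule cops_win_product[where c = c and g = g and A = "\<lambda>\<kappa>. backward_arcs (m (c \<kappa>)) (w \<kappa>)"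
        and B = "backward_arcs (m 1) (w 0)"])
    show "g \<kappa> p r \<in> closed_nbhd (C (c \<kappa>)) p" if "\<kappa> < 2 * l" "p \<in> pverts (C (c \<kappa>))" for \<kappa> p r
      using cyc_moves_closed_nbhd[OF enum[OF that(1)] that(2)] c0 by (auto simp: g_def)
    show "guards (C (c \<kappa>)) (g \<kappa>) (backward_arcs (m (c \<kappa>)) (w \<kappa>))" if "0 < \<kappa>" "\<kappa> < 2 * l" for \<kappa>
      using cyc_guard_guards[OF enum[OF that(2)]] that(1) by (simp add: g_def)
    show "catches (C (c 0)) (g 0) (backward_arcs (m 1) (w 0))"
      using cyc_chase_catches[OF enum[OF l0]] by (simp add: g_def c0)
    show "i = c 0 \<and> (x, y) \<in> backward_arcs (m 1) (w 0) \<or>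
        (\<exists>\<kappa>>0. \<kappa> < 2 * l \<and> c \<kappa> = i \<and> (x, y) \<in> backward_arcs (m (c \<kappa>)) (w \<kappa>))"
      if i: "i \<in> {1..l}" and xy: "(x, y) \<in> parcs (C i)" for i x y
    proof -
      define \<kappa> where "\<kappa> = 2 * (i - 1)"
      have ci: "c \<kappa> = i" "c (Suc \<kappa>) = i" and lt: "\<kappa> < 2 * l" "Suc \<kappa> < 2 * l"
        using i by (auto simp: c_def \<kappa>_def)
      have "w \<kappa> = v i" "w (Suc \<kappa>) = (\<lambda>j. v i (m i - 1 - j))"
        using ci by (simp_all add: w_def \<kappa>_def)
      then consider "(x, y) \<in> backward_arcs (m i) (w \<kappa>)" | "(x, y) \<in> backward_arcs (m i) (w (Suc \<kappa>))"
        using cyc_rev_cover[OF v[OF i]] xy by auto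
      then show ?thesis
      proof cases
        case 1
        then show ?thesis
          using ci lt c0 by (cases "\<kappa> = 0") auto
      next
        case 2
        then show ?thesis
          using ci lt by (intro disjI2 exI[of _ "Suc \<kappa>"]) simp
      qed
    qed
  qed (use l0 conn c_in in auto)
  show "\<not> cops_win (cartesian_product {1..l} C) r" if "r < 2 * l" for r
    using conn cyclic_enum_two_neighbours[OF v] that by (intro not_cops_win_product[where d = 2]) auto
qed

section \<open>Products of trees and of cycles\<close>

theorem corollary4p3:
  fixes T :: "nat \<Rightarrow> 'a pair_pre_digraph" and k :: nat
    and C :: "nat \<Rightarrow> 'b pair_pre_digraph" and m :: "nat \<Rightarrow> nat" and l :: nat
  shows "(1 \<le> k \<and> (\<forall>i\<in>{1..k}. tree_graph (T i)) \<and>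
            (k = 1 \<or> (\<forall>i\<in>{1..k}. 2 \<le> card (pverts (T i))))
          \<longrightarrow> c_cr (cartesian_product {1..k} T) = k) \<and>
         (1 \<le> l \<and> (\<forall>j\<in>{1..l}. cycle_graph (m j) (C j))
          \<longrightarrow> c_cr (cartesian_product {1..l} C) = 2 * l)"
proof (intro conjI impI)
  assume "1 \<le> k \<and> (\<forall>i\<in>{1..k}. tree_graph (T i)) \<and>
    (k = 1 \<or> (\<forall>i\<in>{1..k}. 2 \<le> card (pverts (T i))))"
  then show "c_cr (cartesian_product {1..k} T) = k"
    by (intro c_cr_product_trees) auto
next
  assume "1 \<le> l \<and> (\<forall>j\<in>{1..l}. cycle_graph (m j) (C j))"
  then show "c_cr (cartesian_product {1..l} C) = 2 * l"
    by (intro c_cr_product_cycles[where m = m]) auto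
qed

end
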